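(* Let $(\mathcal{G}(g^j,\Lambda^j))_{j\in\mathcal{J}}$ be a family of Gabor frames for $\mathbf{L}^2(\mathbb{R}^d)$ with separable lattices $\Lambda^j=\alpha^j\mathbb{Z}^d\times\beta^j\mathbb{Z}^d$, and let $(\Omega_r)_{r\in\mathcal{I}}$, $\Omega_r\subseteq B_{R_r}(x_r)\subset\mathbb{R}^{2d}$, be an admissible covering of $\mathbb{R}^{2d}$. Assume that: (i) there are constants $s>2d$ and $C>0$ such that $g^j\in H_{s,C}$ for all $j\in\mathcal{J}$; (ii) the lattice constants are chosen from a compact set in $\mathbb{R}^+\times\mathbb{R}^+$, i.e. $\alpha^j\in[\alpha_0,\alpha_1]\subset(0,\infty)$ and $\beta^j\in[\beta_0,\beta_1]\subset(0,\infty)$ for all $j\in\mathcal{J}$; (iii) the regions assigned to the different Gabor systems are the sets $\Omega_r$, with $\operatorname{supp}(\psi_r)\subseteq\Omega_r\subseteq B_{R_r}(x_r)$ for all $r\in\mathcal{I}$, where $(\psi_r)_{r\in\mathcal{I}}$ is a bounded admissible partition of unity on $\mathbb{R}^{2d}$ subordinate to $(B_{R_r}(x_r))_{r\in\mathcal{I}}$. Let $m:\mathcal{I}\to\mathcal{J}$ be any mapping (assigning a frame to each member of the covering). Then for every finite $\delta\ge 0$ the overall family $$\bigcup_{r\in\mathcal{I}}\{\pi(\lambda)g^{m(r)}:\ \lambda\in\mathcal{X}^r\},\qquad \mathcal{X}^r=\Lambda^{m(r)}\cap B_{R_r+\delta}(x_r),$$ possesses an upper frame bound, i.e. it is a Bessel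 sequence for $\mathbf{L}^2(\mathbb{R}^d)$: there is $B<\infty$ such that $\sum_{r\in\mathcal{I}}\sum_{\lambda\in\mathcal{X}^r}|\langle f,\pi(\lambda)g^{m(r)}\rangle|^2\le B\|f\|_2^2$ for all $f\in\mathbf{L}^2(\mathbb{R}^d)$.
   Context: For $\lambda=(x,\omega)\in\mathbb{R}^{2d}$, $\pi(\lambda)g(t)=e^{2\pi i t\cdot\omega}g(t-x)$. The short-time Fourier transform is $\mathcal{V}_g f(\lambda)=\langle f,\pi(\lambda)g\rangle$. The Gaussian is $g_0(x)=e^{-\pi\|x\|^2}$ on $\mathbb{R}^d$. For $s>2d$, $C>0$, $$H_{s,C}=\{g\in\mathbf{L}^2(\mathbb{R}^d): |\mathcal{V}_{g_0}g(z)|\le C(1+\|z\|^2)^{-s/2}\ \text{for all } z\in\mathbb{R}^{2d}\}.$$ For a lattice $\Lambda\subset\mathbb{R}^{2d}$, $\mathcal{G}(g,\Lambda)=\{\pi(\lambda)g:\lambda\in\Lambda\}$; it is a Gabor frame if there are $A,B>0$ with $A\|f\|_2^2\le\sum_{\lambda\in\Lambda}|\langle f,\pi(\lambda)g\rangle|^2\le B\|f\|_2^2$ for all $f\in\mathbf{L}^2(\mathbb{R}^d)$. $B_R(x)$ is the ball of radius $R$ and center $x$. A family of balls $(B_{R_r}(x_r))_{r\in\mathcal{I}}$ in $\mathbb{R}^{n}$ is an admissible covering if its union is $\mathbb{R}^n$ and there is $n_0\in\mathbb{N}$ such that for every $r\in\mathcal{I}$ the set $r^*=\{s\in\mathcal{I}: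 B_{R_r}(x_r)\cap B_{R_s}(x_s)\ne\emptyset\}$ has at most $n_0$ elements. Standing assumption: for every $\rho>0$ the enlarged family $(B_{R_r+\rho}(x_r))_{r\in\mathcal{I}}$ is also an admissible covering, i.e. there is $n_0(\rho)\in\mathbb{N}$ with $|\{s\in\mathcal{I}: B_{R_r+\rho}(x_r)\cap B_{R_s+\rho}(x_s)\neq\emptyset\}|\le n_0(\rho)$ for all $r\in\mathcal{I}$. A covering $(\Omega_r)_{r\in\mathcal{I}}$ with $\Omega_r\subseteq B_{R_r}(x_r)$ is called admissible if the balls $(B_{R_r}(x_r))_{r\in\mathcal{I}}$ have these properties. A bounded admissible partition of unity subordinate to $(B_{R_r}(x_r))_{r\in\mathcal{I}}$ is a family of non-negative functions $(\psi_r)_{r\in\mathcal{I}}$ with $\sum_r\psi_r\equiv1$ and $\operatorname{supp}\psi_r\subseteq B_{R_r}(x_r)$, the balls forming an admissible covering. *)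

theory Defs
  imports "HOL-Analysis.Analysis"
begin

text \<open>
  Elements of \<open>L\<^sup>2(\<real>\<^sup>d)\<close> are represented by Borel measurable functions; every equivalence class has
  such a representative, and all notions below depend on the class only.
  Phase space \<open>\<real>\<^sup>2\<^sup>d\<close> is the product type, whose norm is the Euclidean one.
\<close>

type_synonym 'd phase = "(real ^ 'd) \<times> (real ^ 'd)"

definition L2 :: "(real ^ 'd \<Rightarrow> complex) set" where
  "L2 = {f. f \<in> borel_measurable lborel \<and> integrable lborel (\<lambda>t. (cmod (f t))\<^sup>2)}"

definition L2_inner :: "(real ^ 'd \<Rightarrow> complex) \<Rightarrow> (real ^ 'd \<Rightarrow> complex) \<Rightarrow> complex" where
  "L2_inner f g = (LINT t|lborel. f t * cnj (g t))"

definition L2_norm :: "(real ^ 'd \<Rightarrow> complex) \<Rightarrow> real" where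
  "L2_norm f = sqrt (LINT t|lborel. (cmod (f t))\<^sup>2)"

definition tf_shift :: "'d phase \<Rightarrow> (real ^ 'd \<Rightarrow> complex) \<Rightarrow> real ^ 'd \<Rightarrow> complex" where
  "tf_shift = (\<lambda>(x, \<omega>) g t. exp (2 * of_real pi * \<i> * of_real (t \<bullet> \<omega>)) * g (t - x))"

definition stft :: "(real ^ 'd \<Rightarrow> complex) \<Rightarrow> (real ^ 'd \<Rightarrow> complex) \<Rightarrow> 'd phase \<Rightarrow> complex" where
  "stft g f z = L2_inner f (tf_shift z g)"

definition gaussian :: "real ^ 'd \<Rightarrow> complex" where
  "gaussian t = of_real (exp (- pi * (norm t)\<^sup>2))"

definition H_class :: "real \<Rightarrow> real \<Rightarrow> (real ^ 'd \<Rightarrow> complex) set" where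
  "H_class s C =
    {g \<in> L2. \<forall>z. cmod (stft gaussian g z) \<le> C * (1 + (norm z)\<^sup>2) powr (- s / 2)}"

definition separable_lattice :: "real \<Rightarrow> real \<Rightarrow> ('d::finite) phase set" where
  "separable_lattice a b =
    {(x, \<omega>). (\<forall>i. \<exists>k::int. x $ i = a * of_int k) \<and> (\<forall>i. \<exists>k::int. \<omega> $ i = b * of_int k)}"

text \<open>
  Sums of squared coefficients are taken in \<open>[0, \<infinity>]\<close>, so a finite upper bound includes convergence.
\<close>

definition gabor_frame :: "(real ^ 'd \<Rightarrow> complex) \<Rightarrow> 'd phase set \<Rightarrow> bool" where
  "gabor_frame g \<Lambda> \<longleftrightarrow> g \<in> L2 \<and>
    (\<exists>A B :: real. 0 < A \<and> 0 < B \<and> (\<forall>f\<in>L2.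
       ennreal (A * (L2_norm f)\<^sup>2)
         \<le> (\<Sum>\<^sub>\<infinity>z\<in>\<Lambda>. ennreal ((cmod (L2_inner f (tf_shift z g)))\<^sup>2)) \<and>
       (\<Sum>\<^sub>\<infinity>z\<in>\<Lambda>. ennreal ((cmod (L2_inner f (tf_shift z g)))\<^sup>2))
         \<le> ennreal (B * (L2_norm f)\<^sup>2)))"

definition ball_neighbours ::
  "'i set \<Rightarrow> ('i \<Rightarrow> 'a::metric_space) \<Rightarrow> ('i \<Rightarrow> real) \<Rightarrow> 'i \<Rightarrow> 'i set" where
  "ball_neighbours I x R r = {s \<in> I. ball (x r) (R r) \<inter> ball (x s) (R s) \<noteq> {}}"

definition admissible_balls ::
  "'i set \<Rightarrow> ('i \<Rightarrow> 'a::metric_space) \<Rightarrow> ('i \<Rightarrow> real) \<Rightarrow> bool" where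
  "admissible_balls I x R \<longleftrightarrow>
    (\<forall>r\<in>I. 0 < R r) \<and>
    (\<Union>r\<in>I. ball (x r) (R r)) = UNIV \<and>
    (\<exists>n0::nat. \<forall>r\<in>I. finite (ball_neighbours I x R r) \<and> card (ball_neighbours I x R r) \<le> n0)"

text \<open>
  The radii may be unbounded, so admissibility of the enlarged families is a genuine requirement.
\<close>

definition admissible_covering ::
  "'i set \<Rightarrow> ('i \<Rightarrow> 'a::metric_space set) \<Rightarrow> ('i \<Rightarrow> 'a) \<Rightarrow> ('i \<Rightarrow> real) \<Rightarrow> bool" where
  "admissible_covering I \<Omega> x R \<longleftrightarrow>
    (\<Union>r\<in>I. \<Omega> r) = UNIV \<and>
    (\<forall>r\<in>I. \<Omega> r \<subseteq> ball (x r) (R r)) \<and>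
    admissible_balls I x R \<and>
    (\<forall>\<rho>>0. admissible_balls I x (\<lambda>r. R r + \<rho>))"

definition supp :: "('a::topological_space \<Rightarrow> real) \<Rightarrow> 'a set" where
  "supp \<psi> = closure {z. \<psi> z \<noteq> 0}"

definition bounded_admissible_partition ::
  "'i set \<Rightarrow> ('i \<Rightarrow> 'a::metric_space \<Rightarrow> real) \<Rightarrow> ('i \<Rightarrow> 'a) \<Rightarrow> ('i \<Rightarrow> real) \<Rightarrow> bool" where
  "bounded_admissible_partition I \<psi> x R \<longleftrightarrow>
    admissible_balls I x R \<and>
    (\<forall>r\<in>I. \<forall>z. 0 \<le> \<psi> r z) \<and>
    (\<forall>z. ((\<lambda>r. \<psi> r z) has_sum 1) I) \<and>
    (\<forall>r\<in>I. supp (\<psi> r) \<subseteq> ball (x r) (R r))"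

end

theory Submission
  imports Defs "HOL-Probability.Characteristic_Functions"
begin

text \<open>
  Let \<open>V f\<close> be the short-time Fourier transform with Gaussian window. Moyal's identity, obtained by
  damping the frequency integral with a Gaussian whose width then tends to infinity, gives
  \<open>\<parallel>V f\<parallel>\<^sup>2 \<le> E \<parallel>f\<parallel>\<^sup>2\<close> and \<open>E \<bar>\<langle>f, h\<rangle>\<bar> \<le> \<integral> \<bar>V f\<bar> \<bar>V h\<bar>\<close>, where \<open>E\<close> is the energy of the window. Since
  \<open>\<bar>V (\<pi>(\<lambda>) g)(z)\<bar> = \<bar>V g (z - \<lambda>)\<bar> \<le> \<Phi> (z - \<lambda>)\<close> with \<open>\<Phi> z = C (1 + \<parallel>z\<parallel>\<^sup>2)\<close> to the power \<open>- s / 2\<close>,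
  Cauchy-Schwarz bounds \<open>E\<^sup>2 \<bar>\<langle>f, \<pi>(\<lambda>) g\<rangle>\<bar>\<^sup>2\<close> by \<open>\<parallel>\<Phi>\<parallel>\<close> (the \<open>L\<^sup>1\<close> norm) times
  \<open>\<integral> \<bar>V f z\<bar>\<^sup>2 \<Phi> (z - \<lambda>) dz\<close>. It remains to bound \<open>\<Sum> \<Phi> (z - \<lambda>)\<close> over all pairs \<open>(r, \<lambda>)\<close> uniformly in \<open>z\<close>.
  This only needs a bound for the number of pairs with \<open>\<lambda>\<close> in a given unit ball \<open>B\<close>: each lattice has
  boundedly many points in \<open>B\<close> by a volume count, and the balls of radius \<open>R r + \<delta> + 1\<close> of all
  contributing \<open>r\<close> contain the centre of \<open>B\<close>, so admissibility of the covering with these enlarged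
  radii bounds the number of \<open>r\<close>.
\<close>

section \<open>Affine substitutions and the Fourier transform of the Gaussian\<close>

lemma nn_integral_lborel_affine:
  fixes f :: "'a::euclidean_space \<Rightarrow> ennreal"
  assumes [measurable]: "f \<in> borel_measurable borel" and "c \<noteq> 0"
  shows "(\<integral>\<^sup>+x. f x \<partial>lborel) = ennreal (\<bar>c\<bar> ^ DIM('a)) * (\<integral>\<^sup>+x. f (t + c *\<^sub>R x) \<partial>lborel)"
  by (subst lborel_affine[OF assms(2), of t])
    (simp add: nn_integral_density nn_integral_distr nn_integral_cmult)

lemma lborel_integrable_affine:
  fixes f :: "'a::euclidean_space \<Rightarrow> 'b::{banach, second_countable_topology}"
  assumes f: "integrable lborel f" and "c \<noteq> 0"
  shows "integrable lborel (\<lambda>x. f (t + c *\<^sub>R x))"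
proof -
  have [measurable]: "f \<in> borel_measurable borel" using f by auto
  have "integrable (density (distr lborel borel (\<lambda>x. t + c *\<^sub>R x)) (\<lambda>_. \<bar>c\<bar>^DIM('a))) f"
    using f lborel_affine[OF assms(2), of t] by metis
  then show ?thesis
    using \<open>c \<noteq> 0\<close> integrable_scaleR_right[of "inverse (\<bar>c\<bar> ^ DIM('a))" lborel "\<lambda>x. \<bar>c\<bar> ^ DIM('a) *\<^sub>R f (t + c *\<^sub>R x)"]
    by (subst (asm) integrable_density) (auto simp: integrable_distr_eq)
qed

lemma lborel_integral_affine:
  fixes f :: "'a::euclidean_space \<Rightarrow> 'b::{banach, second_countable_topology}"
  assumes [measurable]: "f \<in> borel_measurable borel" and "c \<noteq> 0"
  shows "(\<integral>x. f x \<partial>lborel) = \<bar>c\<bar> ^ DIM('a) *\<^sub>R (\<integral>x. f (t + c *\<^sub>R x) \<partial>lborel)"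
  by (subst lborel_affine[OF assms(2), of t])
    (simp add: integral_density integral_distr)

text \<open>Fubini over the coordinates. It reduces the Fourier transform of the Gaussian to one
  dimension.\<close>

lemma integrable_lborel_prod:
  fixes f :: "'a::euclidean_space \<Rightarrow> real \<Rightarrow> 'b::{real_normed_field, banach, second_countable_topology}"
  assumes int: "\<And>b. b \<in> Basis \<Longrightarrow> integrable lborel (f b)"
  shows "integrable lborel (\<lambda>x::'a. \<Prod>b\<in>Basis. f b (x \<bullet> b))"
    and "(\<integral>x. (\<Prod>b\<in>Basis. f b (x \<bullet> b)) \<partial>(lborel :: 'a measure)) = (\<Prod>b\<in>Basis. (\<integral>x. f b x \<partial>lborel))"
proof -
  interpret product_sigma_finite "\<lambda>_::'a. lborel :: real measure" ..
  \<comment> \<open>\<open>lborel\<close> is built from copies of the real interval measure, one per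
    basis vector; \<open>lborel_eq_real\<close> identifies each copy with one-dimensional Lebesgue
    measure.\<close>
  have P: "(lborel :: 'a measure)
    = distr (\<Pi>\<^sub>M b\<in>Basis. (lborel :: real measure)) borel (\<lambda>f. \<Sum>b\<in>Basis. f b *\<^sub>R b)"
    unfolding lborel_eq_real by (rule lborel_def)
  have [measurable]: "f b \<in> borel_measurable borel" if "b \<in> Basis" for b
    using int[OF that] by auto
  have coord: "(\<Prod>b\<in>Basis. f b ((\<Sum>c\<in>Basis. p c *\<^sub>R c) \<bullet> b)) = (\<Prod>b\<in>Basis. f b (p b))"
    for p :: "'a \<Rightarrow> real" by (intro prod.cong) auto
  show "integrable lborel (\<lambda>x::'a. \<Prod>b\<in>Basis. f b (x \<bullet> b))"
    using product_integrable_prod[of Basis f] int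
    by (simp add: P integrable_distr_eq coord)
  show "(\<integral>x. (\<Prod>b\<in>Basis. f b (x \<bullet> b)) \<partial>(lborel :: 'a measure)) = (\<Prod>b\<in>Basis. (\<integral>x. f b x \<partial>lborel))"
    using product_integral_prod[of Basis f] int
    by (simp add: P integral_distr coord)
qed

lemma borel_measurable_cis [measurable]:
  assumes [measurable]: "f \<in> borel_measurable M"
  shows "(\<lambda>x. cis (f x)) \<in> borel_measurable M"
proof -
  have "cis \<in> borel_measurable borel"
    by (intro borel_measurable_continuous_onI) (auto simp: cis_conv_exp intro!: continuous_intros)
  then show ?thesis by simp
qed

text \<open>This is the characteristic function of the standard normal distribution at
  \<open>?t\<close>, rescaled so that the exponent \<open>- x\<^sup>2 / 2\<close> becomes
  \<open>- pi * w\<^sup>2\<close>.\<close>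

lemma gaussian_fourier_real:
  "integrable lborel (\<lambda>w::real. cis (2 * pi * (y * w)) * of_real (exp (- pi * w\<^sup>2)))"
  "(\<integral>w. cis (2 * pi * (y * w)) * of_real (exp (- pi * w\<^sup>2)) \<partial>lborel) = of_real (exp (- pi * y\<^sup>2))"
proof -
  let ?h = "\<lambda>x::real. cis (- sqrt (2 * pi) * y * x) * complex_of_real (std_normal_density x)"
  let ?t = "- sqrt (2 * pi) * y"
  have int: "integrable lborel ?h"
    by (rule Bochner_Integration.integrable_bound[OF integrable_normal_density[of 1 0]])
      (auto simp: norm_mult norm_cis normal_density_nonneg)
  have val: "integral\<^sup>L lborel ?h = of_real (exp (- pi * y\<^sup>2))"
  proof -
    have "char std_normal_distribution ?t = integral\<^sup>L lborel ?h"
      unfolding char_def by (subst integral_density)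
        (auto simp: cis_conv_exp scaleR_conv_of_real normal_density_nonneg mult_ac intro!: Bochner_Integration.integral_cong)
    then show ?thesis
      by (simp add: char_std_normal_distribution power_mult_distrib)
  qed
  have c: "- sqrt (2 * pi) \<noteq> 0" by simp
  \<comment> \<open>The substitution is \<open>x = - sqrt (2 * pi) * w\<close>. Its Jacobian cancels
    the normalisation of the density, and its sign cancels that of \<open>?t\<close>, so that the
    phase becomes \<open>2 * pi * (y * w)\<close>.\<close>
  have eq: "sqrt (2 * pi) *\<^sub>R ?h (0 + (- sqrt (2 * pi)) *\<^sub>R w) = cis (2 * pi * (y * w)) * of_real (exp (- pi * w\<^sup>2))" for w
  proof -
    have "sqrt (2 * pi) * (sqrt (2 * pi) * (y * w)) = 2 * pi * (y * w)"
      by (simp flip: mult.assoc)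
    then show ?thesis
      by (simp add: std_normal_density_def power_mult_distrib scaleR_conv_of_real mult_ac)
  qed
  show "integrable lborel (\<lambda>w::real. cis (2 * pi * (y * w)) * of_real (exp (- pi * w\<^sup>2)))"
    using lborel_integrable_affine[OF int c, of 0, THEN integrable_scaleR_right, of "sqrt (2 * pi)"] by (simp only: eq)
  show "(\<integral>w. cis (2 * pi * (y * w)) * of_real (exp (- pi * w\<^sup>2)) \<partial>lborel) = of_real (exp (- pi * y\<^sup>2))"
    unfolding eq[symmetric] val[symmetric] by (subst lborel_integral_affine[OF _ c, of ?h 0]) auto
qed

lemma norm_sq_Basis: "(norm (x::'a::euclidean_space))\<^sup>2 = (\<Sum>b\<in>Basis. (x \<bullet> b)\<^sup>2)"
  unfolding power2_norm_eq_inner by (subst euclidean_inner) (simp add: power2_eq_square)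

text \<open>Real-valued counterpart of the window: \<open>gaussian t\<close> is
  \<open>of_real (gauss t)\<close>.\<close>

definition gauss :: "'a::euclidean_space \<Rightarrow> real" where
  "gauss x = exp (- pi * (norm x)\<^sup>2)"

lemma gauss_pos: "0 < gauss x" and gauss_le_1: "gauss x \<le> 1"
  by (simp_all add: gauss_def)

lemma gauss_minus: "gauss (- x) = gauss x"
  by (simp add: gauss_def)

lemma borel_measurable_gauss [measurable]: "gauss \<in> borel_measurable borel"
  unfolding gauss_def by measurable

text \<open>Both the character and the Gaussian are products over the coordinates, so the
  one-dimensional formula applies in each of them.\<close>

lemma gaussian_fourier:
  fixes y :: "'a::euclidean_space"
  shows "integrable lborel (\<lambda>w::'a. cis (2 * pi * (y \<bullet> w)) * of_real (gauss w))"
    and "(\<integral>w. cis (2 * pi * (y \<bullet> w)) * of_real (gauss w) \<partial>lborel)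
      = of_real (gauss y)"
proof -
  define f where "f b w = cis (2 * pi * ((y \<bullet> b) * w)) * complex_of_real (exp (- pi * w\<^sup>2))" for b w
  have cis_sum: "cis (\<Sum>b\<in>B. g b) = (\<Prod>b\<in>B. cis (g b))" for g and B :: "'a set"
    by (induction B rule: infinite_finite_induct) (auto simp flip: cis_mult)
  have eq: "cis (2 * pi * (y \<bullet> w)) * of_real (gauss w) = (\<Prod>b\<in>Basis. f b (w \<bullet> b))" for w
    unfolding f_def prod.distrib gauss_def norm_sq_Basis
    by (subst euclidean_inner[of y w])
      (simp add: sum_distrib_left exp_sum cis_sum mult_ac flip: of_real_prod sum_negf)
  have eq2: "complex_of_real (gauss y) = (\<Prod>b\<in>Basis. of_real (exp (- pi * (y \<bullet> b)\<^sup>2)))"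
    unfolding gauss_def norm_sq_Basis by (simp add: sum_distrib_left exp_sum flip: of_real_prod sum_negf)
  have int: "integrable lborel (f b)" for b
    unfolding f_def by (rule gaussian_fourier_real)
  have val: "integral\<^sup>L lborel (f b) = of_real (exp (- pi * (y \<bullet> b)\<^sup>2))" for b
    unfolding f_def by (rule gaussian_fourier_real)
  show "integrable lborel (\<lambda>w::'a. cis (2 * pi * (y \<bullet> w)) * of_real (gauss w))"
    unfolding eq by (rule integrable_lborel_prod(1)[OF int])
  show "(\<integral>w. cis (2 * pi * (y \<bullet> w)) * of_real (gauss w) \<partial>lborel)
      = of_real (gauss y)"
    unfolding eq eq2 by (subst integrable_lborel_prod(2)[OF int]) (simp_all add: val)
qed

lemma gaussian_integral:
  "integrable lborel (\<lambda>w::'a::euclidean_space. gauss w)"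
  "(\<integral>w. gauss (w::'a::euclidean_space) \<partial>lborel) = 1"
proof -
  show "integrable lborel (\<lambda>w::'a::euclidean_space. gauss w)"
    using integrable_norm[OF gaussian_fourier(1)[where 'a='a and y=0]] by (simp add: norm_mult gauss_def)
  show "(\<integral>w. gauss (w::'a::euclidean_space) \<partial>lborel) = 1"
    using gaussian_fourier(2)[where 'a='a and y=0] by (simp add: gauss_def)
qed

lemma gaussian_fourier_scaled:
  fixes y :: "'a::euclidean_space"
  assumes "a > 0"
  shows "integrable lborel (\<lambda>w::'a. cis (2 * pi * (y \<bullet> w)) * of_real (gauss (a *\<^sub>R w)))"
    and "(\<integral>w. cis (2 * pi * (y \<bullet> w)) * of_real (gauss (a *\<^sub>R w)) \<partial>lborel)
      = of_real (gauss (y /\<^sub>R a) / a ^ DIM('a))"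
proof -
  show "integrable lborel (\<lambda>w::'a. cis (2 * pi * (y \<bullet> w)) * of_real (gauss (a *\<^sub>R w)))"
    using lborel_integrable_affine[OF gaussian_fourier(1)[of "y /\<^sub>R a"], of a 0] assms by (simp flip: mult.assoc)
  show "(\<integral>w. cis (2 * pi * (y \<bullet> w)) * of_real (gauss (a *\<^sub>R w)) \<partial>lborel)
      = of_real (gauss (y /\<^sub>R a) / a ^ DIM('a))"
    using gaussian_fourier(2)[of "y /\<^sub>R a", symmetric] assms
    by (subst (asm) lborel_integral_affine[where c=a and t=0]) (auto simp: scaleR_conv_of_real field_simps)
qed

section \<open>Square integrable functions and continuity of translation\<close>

lemma borel_measurable_cnj [measurable]:
  assumes [measurable]: "f \<in> borel_measurable M"
  shows "(\<lambda>x. cnj (f x)) \<in> borel_measurable M"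
proof -
  have "cnj \<in> borel_measurable borel"
    by (intro borel_measurable_continuous_onI continuous_intros)
  then show ?thesis by simp
qed

lemma L2D:
  assumes "f \<in> L2"
  shows "f \<in> borel_measurable borel" "integrable lborel (\<lambda>t. (cmod (f t))\<^sup>2)"
  using assms by (auto simp: L2_def)

lemma L2I:
  assumes "f \<in> borel_measurable borel" "integrable lborel (\<lambda>t. (cmod (f t))\<^sup>2)"
  shows "f \<in> L2"
  using assms by (auto simp: L2_def)

lemma L2_mono:
  assumes "f \<in> L2" and [measurable]: "h \<in> borel_measurable borel" and le: "\<And>t. cmod (h t) \<le> cmod (f t)"
  shows "h \<in> L2"
  by (intro L2I Bochner_Integration.integrable_bound[OF L2D(2)[OF assms(1)]])
    (auto intro!: power_mono le)

lemma L2_norm_nonneg: "0 \<le> L2_norm f"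
  by (simp add: L2_norm_def)

lemma L2_norm_square: "(L2_norm f)\<^sup>2 = (\<integral>t. (cmod (f t))\<^sup>2 \<partial>lborel)"
  by (simp add: L2_norm_def)

lemma L2_norm_square_nn:
  assumes "f \<in> L2"
  shows "ennreal ((L2_norm f)\<^sup>2) = (\<integral>\<^sup>+t. (cmod (f t))\<^sup>2 \<partial>lborel)"
  unfolding L2_norm_square using L2D(2)[OF assms] by (simp add: nn_integral_eq_integral)

text \<open>Integrability comes from \<open>a * b <= a^2 + b^2\<close>; the sharp bound is then
  Cauchy-Schwarz for nonnegative integrals, transferred back to real integrals.\<close>

lemma L2_mult_integrable:
  assumes f: "f \<in> L2" and h: "h \<in> L2"
  shows "integrable lborel (\<lambda>t. cmod (f t) * cmod (h t))"
    and "(\<integral>t. cmod (f t) * cmod (h t) \<partial>lborel) \<le> L2_norm f * L2_norm h"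
proof -
  note [measurable] = L2D(1)[OF f] L2D(1)[OF h]
  show int: "integrable lborel (\<lambda>t. cmod (f t) * cmod (h t))"
  proof (rule Bochner_Integration.integrable_bound[OF Bochner_Integration.integrable_add[OF L2D(2)[OF f] L2D(2)[OF h]]])
    have "a * b \<le> a\<^sup>2 + b\<^sup>2" if "0 \<le> a" "0 \<le> b" for a b :: real
      using sum_squares_bound[of a b] mult_nonneg_nonneg[OF that] by linarith
    then show "AE t in lborel. norm (cmod (f t) * cmod (h t)) \<le> norm ((cmod (f t))\<^sup>2 + (cmod (h t))\<^sup>2)"
      by (intro AE_I2) (simp add: abs_mult)
  qed auto
  have "(\<integral>\<^sup>+t. ennreal (cmod (f t)) * ennreal (cmod (h t)) \<partial>lborel)\<^sup>2
      \<le> (\<integral>\<^sup>+t. (ennreal (cmod (f t)))\<^sup>2 \<partial>lborel) * (\<integral>\<^sup>+t. (ennreal (cmod (h t)))\<^sup>2 \<partial>lborel)"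
    by (rule Cauchy_Schwarz_nn_integral) auto
  also have "\<dots> = ennreal ((L2_norm f * L2_norm h)\<^sup>2)"
    by (simp add: L2_norm_square_nn f h ennreal_power ennreal_mult power_mult_distrib)
  also have "(\<integral>\<^sup>+t. ennreal (cmod (f t)) * ennreal (cmod (h t)) \<partial>lborel)
      = ennreal (\<integral>t. cmod (f t) * cmod (h t) \<partial>lborel)"
    using int by (simp add: nn_integral_eq_integral flip: ennreal_mult)
  finally have "(\<integral>t. cmod (f t) * cmod (h t) \<partial>lborel)\<^sup>2 \<le> (L2_norm f * L2_norm h)\<^sup>2"
    by (simp add: ennreal_power)
  then show "(\<integral>t. cmod (f t) * cmod (h t) \<partial>lborel) \<le> L2_norm f * L2_norm h"
    by (rule power2_le_imp_le) (simp add: L2_norm_nonneg)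
qed

lemma L2_inner_integrable:
  assumes f: "f \<in> L2" and h: "h \<in> L2"
  shows "integrable lborel (\<lambda>t. f t * cnj (h t))"
    and "cmod (L2_inner f h) \<le> L2_norm f * L2_norm h"
proof -
  note [measurable] = L2D(1)[OF f] L2D(1)[OF h]
  show int: "integrable lborel (\<lambda>t. f t * cnj (h t))"
    by (rule Bochner_Integration.integrable_bound[OF L2_mult_integrable(1)[OF f h]]) (auto simp: norm_mult)
  have "cmod (L2_inner f h) \<le> (\<integral>t. cmod (f t) * cmod (h t) \<partial>lborel)"
    unfolding L2_inner_def using integral_norm_bound[of lborel "\<lambda>t. f t * cnj (h t)"] by (simp add: norm_mult)
  then show "cmod (L2_inner f h) \<le> L2_norm f * L2_norm h"
    using L2_mult_integrable(2)[OF f h] by linarith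
qed

lemma L2_diff:
  assumes f: "f \<in> L2" and h: "h \<in> L2"
  shows "(\<lambda>t. f t - h t) \<in> L2"
proof (rule L2I)
  note [measurable] = L2D(1)[OF f] L2D(1)[OF h]
  show "(\<lambda>t. f t - h t) \<in> borel_measurable borel" by measurable
  have "(cmod (a - b))\<^sup>2 \<le> 2 * (cmod a)\<^sup>2 + 2 * (cmod b)\<^sup>2" for a b
  proof -
    have "(cmod (a - b))\<^sup>2 \<le> (cmod a + cmod b)\<^sup>2" by (intro power_mono norm_triangle_ineq4) auto
    then show ?thesis using sum_squares_bound[of "cmod a" "cmod b"] by (simp add: power2_sum)
  qed
  then show "integrable lborel (\<lambda>t. (cmod (f t - h t))\<^sup>2)"
    by (intro Bochner_Integration.integrable_bound[OF Bochner_Integration.integrable_add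
          [OF integrable_mult_right[OF L2D(2)[OF f], of 2] integrable_mult_right[OF L2D(2)[OF h], of 2]]]) auto
qed

lemma L2_inner_diff:
  assumes "f \<in> L2" "f' \<in> L2" "h \<in> L2"
  shows "L2_inner (\<lambda>t. f t - f' t) h = L2_inner f h - L2_inner f' h"
    and "L2_inner h (\<lambda>t. f t - f' t) = L2_inner h f - L2_inner h f'"
  using assms by (simp_all add: L2_inner_def left_diff_distrib right_diff_distrib L2_inner_integrable(1))

section \<open>Translations of square integrable functions and their weak continuity\<close>

lemma L2_translate:
  assumes f: "f \<in> L2"
  shows "(\<lambda>t. f (t + y)) \<in> L2" and "L2_norm (\<lambda>t. f (t + y)) = L2_norm f"
proof -
  note [measurable] = L2D(1)[OF f]
  show "(\<lambda>t. f (t + y)) \<in> L2"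
    using lborel_integrable_affine[OF L2D(2)[OF f], of 1 y] by (intro L2I) (auto simp: add.commute)
  show "L2_norm (\<lambda>t. f (t + y)) = L2_norm f"
    unfolding L2_norm_def by (subst (2) lborel_integral_affine[where t=y and c=1]) (auto simp: add.commute)
qed

text \<open>A three-epsilon argument in which the comparison sequence \<open>G\<close> and its limit
  \<open>l\<close> may change with \<open>e\<close>. Two of the three errors are only weakly
  bounded; taking \<open>e / 4\<close> for each makes the total strictly smaller than
  \<open>e\<close>.\<close>

lemma tendsto_approx:
  fixes F :: "nat \<Rightarrow> 'a::metric_space"
  assumes "\<And>e. e > 0 \<Longrightarrow> \<exists>G l. (\<forall>\<^sub>F n in sequentially. dist (F n) (G n) \<le> e) \<and> dist L l \<le> e \<and> G \<longlonglongrightarrow> l"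
  shows "F \<longlonglongrightarrow> L"
proof (rule tendstoI)
  fix e :: real assume "e > 0"
  then obtain G l where G: "\<forall>\<^sub>F n in sequentially. dist (F n) (G n) \<le> e / 4" "dist L l \<le> e / 4" "G \<longlonglongrightarrow> l"
    using assms[of "e / 4"] by auto
  have "\<forall>\<^sub>F n in sequentially. dist (G n) l < e / 4"
    using tendstoD[OF G(3), of "e / 4"] \<open>e > 0\<close> by simp
  with G(1) show "\<forall>\<^sub>F n in sequentially. dist (F n) L < e"
  proof eventually_elim
    case (elim n)
    have "dist (F n) L \<le> dist (F n) (G n) + dist (G n) l + dist L l"
      by (metis add.commute add_left_mono dist_commute dist_triangle dist_triangle_le order_trans)
    then show ?case using elim G(2) \<open>e > 0\<close> by linarith
  qed
qed

text \<open>Bounded continuous functions approximate \<open>f\<close> almost everywhere. For them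
  the translates converge pointwise and dominated convergence applies; the approximation error is
  bounded uniformly over all shifts of norm at most 1.\<close>

lemma L2_inner_translate_tendsto_bounded:
  fixes f h :: "real ^ 'd \<Rightarrow> complex"
  assumes [measurable]: "f \<in> borel_measurable borel" "h \<in> borel_measurable borel"
    and M: "M > 0" and f: "\<And>t. cmod (f t) \<le> M" and h: "\<And>t. cmod (h t) \<le> M"
    and supp: "\<And>t. t \<notin> ball 0 M \<Longrightarrow> h t = 0" and y: "y \<longlonglongrightarrow> 0"
  shows "(\<lambda>n. L2_inner (\<lambda>t. f (t + y n)) h) \<longlonglongrightarrow> L2_inner f h"
proof -
  \<comment> \<open>The notion \<open>measurable_on\<close> provides continuous functions converging
    to \<open>f\<close> outside a negligible set.\<close>
  have "f measurable_on UNIV"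
    by (intro lebesgue_measurable_imp_measurable_on measurable_completion) auto
  then obtain N g' where N: "negligible N" and g'c: "\<And>k. continuous_on UNIV (g' k)"
    and g'l: "\<And>x. x \<notin> N \<Longrightarrow> (\<lambda>k. g' k x) \<longlonglongrightarrow> f x"
    unfolding measurable_on_def by auto
  \<comment> \<open>The projection onto the disc of radius \<open>M\<close> is continuous and fixes
    the values of \<open>f\<close>. It makes the approximants bounded by \<open>M\<close> without
    destroying the convergence.\<close>
  define P where "P = closest_point (cball (0::complex) M)"
  have contP: "continuous_on UNIV P" unfolding P_def
    using M by (intro continuous_on_closest_point) auto
  define g where "g k x = P (g' k x)" for k x
  have gc: "continuous_on UNIV (g k)" for k
    unfolding g_def using continuous_on_compose2[OF contP g'c] by auto
  have gM: "cmod (g k x) \<le> M" for k x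
    using closest_point_in_set[of "cball (0::complex) M" "g' k x"] M by (auto simp: g_def P_def)
  have gl: "(\<lambda>k. g k x) \<longlonglongrightarrow> f x" if "x \<notin> N" for x
  proof -
    have "(\<lambda>k. P (g' k x)) \<longlonglongrightarrow> P (f x)"
      using contP g'l[OF that] by (auto simp: continuous_on_eq_continuous_at intro: isCont_tendsto_compose)
    moreover have "P (f x) = f x" unfolding P_def by (rule closest_point_self) (simp add: f)
    ultimately show ?thesis by (simp add: g_def)
  qed
  have [measurable]: "g k \<in> borel_measurable borel" for k
    by (rule borel_measurable_continuous_onI[OF gc])
  have ball_int: "integrable lborel (\<lambda>t::real^'d. c * indicator (ball 0 r) t)" for c r :: real
    by (intro integrable_mult_right integrable_real_indicator emeasure_bounded_finite) auto
  have AEN: "AE t in lborel. t \<notin> N"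
    using N by (simp add: negligible_iff_null_sets eventually_ae_filter null_sets_completion_iff2)
  have [measurable]: "ball (0::real^'d) r \<in> sets borel" for r by simp
  \<comment> \<open>\<open>D k\<close> is the \<open>L1\<close> distance of \<open>f\<close> and
    \<open>g k\<close> on a ball of radius \<open>M + 1\<close>: this ball contains every translate,
    by a vector of norm at most 1, of the ball that carries \<open>h\<close>.\<close>
  define D where "D k = (\<integral>t. indicator (ball 0 (M + 1)) t * cmod (f t - g k t) \<partial>lborel)" for k
  have Dint: "integrable lborel (\<lambda>t. indicator (ball 0 (M + 1)) t * cmod (f t - g k t))" for k
  proof (rule Bochner_Integration.integrable_bound[OF ball_int[of "2 * M" "M + 1"]])
    have "cmod (f t - g k t) \<le> 2 * M" for t
      using norm_triangle_ineq4[of "f t" "g k t"] f[of t] gM[of k t] by linarith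
    then show "AE t in lborel. norm (indicator (ball 0 (M + 1)) t * cmod (f t - g k t))
        \<le> norm (2 * M * indicator (ball 0 (M + 1)) t)"
      using M by (intro AE_I2) (auto simp: indicator_def)
  qed auto
  have "D \<longlonglongrightarrow> (\<integral>t. 0 \<partial>(lborel :: (real^'d) measure))" unfolding D_def
  proof (rule integral_dominated_convergence[OF _ _ ball_int[of "2 * M" "M + 1"]])
    show "AE t in lborel. (\<lambda>k. indicator (ball 0 (M + 1)) t * cmod (f t - g k t)) \<longlonglongrightarrow> 0"
      using AEN
    proof eventually_elim
      case (elim t)
      have "(\<lambda>k. indicator (ball 0 (M + 1)) t * cmod (f t - g k t)) \<longlonglongrightarrow> indicator (ball 0 (M + 1)) t * cmod (f t - f t)"
        by (intro tendsto_intros gl elim)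
      then show ?case by simp
    qed
    have "cmod (f t - g k t) \<le> 2 * M" for t k
      using norm_triangle_ineq4[of "f t" "g k t"] f[of t] gM[of k t] by linarith
    then show "AE t in lborel. norm (indicator (ball 0 (M + 1)) t * cmod (f t - g k t))
        \<le> 2 * M * indicator (ball 0 (M + 1)) t" for k
      using M by (intro AE_I2) (auto simp: indicator_def)
  qed auto
  then have D0: "D \<longlonglongrightarrow> 0" by simp
  have hL2: "h \<in> L2"
    by (intro L2I Bochner_Integration.integrable_bound[OF ball_int[of "M\<^sup>2" M]] AE_I2)
      (use h supp M in \<open>auto simp: indicator_def intro!: power_mono\<close>)
  have int: "integrable lborel (\<lambda>t. F (t + z) * cnj (h t))"
    if [measurable]: "F \<in> borel_measurable borel" and F: "\<And>t. cmod (F t) \<le> M" for F z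
  proof (rule Bochner_Integration.integrable_bound[OF ball_int[of "M * M" M]])
    show "AE t in lborel. norm (F (t + z) * cnj (h t)) \<le> norm (M * M * indicator (ball 0 M) t)"
      using F h supp M by (intro AE_I2) (auto simp: indicator_def norm_mult intro!: mult_mono)
  qed auto
  have close: "dist (L2_inner (\<lambda>t. f (t + z)) h) (L2_inner (\<lambda>t. g k (t + z)) h) \<le> M * D k"
    if z: "norm z \<le> 1" for k z
  proof -
    have "dist (L2_inner (\<lambda>t. f (t + z)) h) (L2_inner (\<lambda>t. g k (t + z)) h)
      = cmod (\<integral>t. (f (t + z) - g k (t + z)) * cnj (h t) \<partial>lborel)"
      unfolding L2_inner_def dist_norm left_diff_distrib
      by (subst Bochner_Integration.integral_diff) (auto intro!: int f gM)
    also have "\<dots> \<le> (\<integral>t. M * (indicator (ball 0 (M + 1)) (z + 1 *\<^sub>R t) * cmod (f (z + 1 *\<^sub>R t) - g k (z + 1 *\<^sub>R t))) \<partial>lborel)"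
    proof (rule Bochner_Integration.integral_norm_bound_integral)
      show "integrable lborel (\<lambda>t. (f (t + z) - g k (t + z)) * cnj (h t))"
        unfolding left_diff_distrib by (intro Bochner_Integration.integrable_diff int f gM) auto
      show "integrable lborel (\<lambda>t. M * (indicator (ball 0 (M + 1)) (z + 1 *\<^sub>R t) * cmod (f (z + 1 *\<^sub>R t) - g k (z + 1 *\<^sub>R t))))"
        by (intro integrable_mult_right lborel_integrable_affine[OF Dint]) auto
      fix t
      show "norm ((f (t + z) - g k (t + z)) * cnj (h t)) \<le> M * (indicator (ball 0 (M + 1)) (z + 1 *\<^sub>R t) * cmod (f (z + 1 *\<^sub>R t) - g k (z + 1 *\<^sub>R t)))"
      proof (cases "t \<in> ball 0 M")
        case True
        have "norm (z + t) < M + 1" using True z norm_triangle_ineq[of z t] by auto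
        then show ?thesis using h[of t] by (auto simp: norm_mult add.commute mult.commute intro!: mult_right_mono)
      qed (use supp M in auto)
    qed
    also have "\<dots> = M * D k"
      unfolding D_def integral_mult_right_zero by (subst (2) lborel_integral_affine[where t=z and c=1]) auto
    finally show ?thesis .
  qed
  have G: "(\<lambda>n. L2_inner (\<lambda>t. g k (t + y n)) h) \<longlonglongrightarrow> L2_inner (\<lambda>t. g k t) h" for k
    unfolding L2_inner_def
  proof (rule integral_dominated_convergence[OF _ _ ball_int[of "M * M" M]])
    show "AE t in lborel. (\<lambda>n. g k (t + y n) * cnj (h t)) \<longlonglongrightarrow> g k t * cnj (h t)"
    proof (intro AE_I2 tendsto_intros)
      fix t
      have "(\<lambda>n. t + y n) \<longlonglongrightarrow> t" using tendsto_add[OF tendsto_const y, of t] by simp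
      then show "(\<lambda>n. g k (t + y n)) \<longlonglongrightarrow> g k t"
        using gc[of k] by (auto simp: continuous_on_eq_continuous_at intro: isCont_tendsto_compose)
    qed
    show "AE t in lborel. norm (g k (t + y n) * cnj (h t)) \<le> M * M * indicator (ball 0 M) t" for n
      using gM h supp M by (intro AE_I2) (auto simp: indicator_def norm_mult intro!: mult_mono)
  qed auto
  show ?thesis
  proof (rule tendsto_approx)
    fix e :: real assume "e > 0"
    then have "\<forall>\<^sub>F k in sequentially. dist (D k) 0 < e / M" using M D0 by (intro tendstoD) auto
    then obtain k where "dist (D k) 0 < e / M" by (auto simp: eventually_sequentially)
    then have k: "M * D k \<le> e" using M by (simp add: field_simps dist_real_def abs_less_iff)
    have "\<forall>\<^sub>F n in sequentially. dist (y n) 0 < 1" using y by (rule tendstoD) auto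
    then have "\<forall>\<^sub>F n in sequentially. dist (L2_inner (\<lambda>t. f (t + y n)) h) (L2_inner (\<lambda>t. g k (t + y n)) h) \<le> e"
      by eventually_elim (rule order_trans[OF close k], simp)
    moreover have "dist (L2_inner f h) (L2_inner (g k) h) \<le> e"
      using order_trans[OF close[of 0 k] k] by simp
    ultimately show "\<exists>G l. (\<forall>\<^sub>F n in sequentially. dist (L2_inner (\<lambda>t. f (t + y n)) h) (G n) \<le> e)
        \<and> dist (L2_inner f h) l \<le> e \<and> G \<longlonglongrightarrow> l"
      using G[of k] by (intro exI conjI)
  qed
qed

text \<open>Dominated convergence with majorant the squared modulus of \<open>f\<close>. The
  predicate \<open>A\<close> covers truncation by height as well as by height and support.\<close>

lemma L2_truncation_tendsto:
  fixes f :: "real ^ 'd \<Rightarrow> complex"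
  assumes f: "f \<in> L2" and [measurable]: "\<And>k. {t. A k t} \<in> sets borel"
    and ev: "\<And>t. \<forall>\<^sub>F k in sequentially. A k t"
  shows "(\<lambda>k. L2_norm (\<lambda>t. f t - (if A k t then f t else 0))) \<longlonglongrightarrow> 0"
proof -
  note [measurable] = L2D(1)[OF f]
  have [measurable]: "Measurable.pred borel (A k)" for k
    using assms(2)[of k] by (simp add: pred_def)
  have "(\<lambda>k. \<integral>t. (cmod (f t - (if A k t then f t else 0)))\<^sup>2 \<partial>lborel) \<longlonglongrightarrow> (\<integral>t. 0 \<partial>(lborel :: (real^'d) measure))"
  proof (rule integral_dominated_convergence[OF _ _ L2D(2)[OF f]])
    show "AE t in lborel. (\<lambda>k. (cmod (f t - (if A k t then f t else 0)))\<^sup>2) \<longlonglongrightarrow> 0"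
    proof (rule AE_I2)
      fix t
      have "\<forall>\<^sub>F k in sequentially. (cmod (f t - (if A k t then f t else 0)))\<^sup>2 = 0"
        using ev[of t] by eventually_elim simp
      then show "(\<lambda>k. (cmod (f t - (if A k t then f t else 0)))\<^sup>2) \<longlonglongrightarrow> 0"
        by (rule tendsto_eventually)
    qed
  qed auto
  then show ?thesis
    unfolding L2_norm_def using tendsto_real_sqrt by fastforce
qed

text \<open>Truncation reduces the claim to the bounded case. Translation preserves the
  \<open>L2\<close> norm, so by Cauchy-Schwarz the truncation error is bounded independently of the
  shift.\<close>

lemma L2_inner_translate_tendsto:
  fixes f h :: "real ^ 'd \<Rightarrow> complex"
  assumes f: "f \<in> L2" and h: "h \<in> L2" and y: "y \<longlonglongrightarrow> 0"
  shows "(\<lambda>n. L2_inner (\<lambda>t. f (t + y n)) h) \<longlonglongrightarrow> L2_inner f h"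
proof (rule tendsto_approx)
  fix e :: real assume e: "e > 0"
  note [measurable] = L2D(1)[OF f] L2D(1)[OF h]
  define fk where "fk k t = (if cmod (f t) \<le> real k then f t else 0)" for k t
  define hk where "hk k t = (if cmod (h t) \<le> real k \<and> norm t < real k then h t else 0)" for k t
  have ev: "\<forall>\<^sub>F k in sequentially. r \<le> real k" "\<forall>\<^sub>F k in sequentially. r < real k" for r :: real
    using filterlim_real_sequentially by (simp add: filterlim_at_top, simp only: filterlim_at_top_dense)
  have "(\<lambda>k. L2_norm (\<lambda>t. f t - fk k t)) \<longlonglongrightarrow> 0"
    unfolding fk_def by (intro L2_truncation_tendsto f ev) measurable
  moreover have "(\<lambda>k. L2_norm (\<lambda>t. h t - hk k t)) \<longlonglongrightarrow> 0"
    unfolding hk_def by (intro L2_truncation_tendsto h eventually_conj ev) measurable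
  ultimately have "(\<lambda>k. L2_norm (\<lambda>t. f t - fk k t) * L2_norm h + L2_norm f * L2_norm (\<lambda>t. h t - hk k t)) \<longlonglongrightarrow> 0"
    by (auto intro!: tendsto_eq_intros)
  then have "\<forall>\<^sub>F k in sequentially. dist (L2_norm (\<lambda>t. f t - fk k t) * L2_norm h + L2_norm f * L2_norm (\<lambda>t. h t - hk k t)) 0 < e"
    using e by (rule tendstoD)
  \<comment> \<open>Positivity of \<open>k\<close> is recorded because \<open>real k\<close> serves
    as the bound \<open>M > 0\<close> of the bounded case.\<close>
  then have "\<forall>\<^sub>F k in sequentially. dist (L2_norm (\<lambda>t. f t - fk k t) * L2_norm h + L2_norm f * L2_norm (\<lambda>t. h t - hk k t)) 0 < e \<and> k > 0"
    using eventually_gt_at_top[of "0::nat"] by eventually_elim simp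
  then obtain k where "dist (L2_norm (\<lambda>t. f t - fk k t) * L2_norm h + L2_norm f * L2_norm (\<lambda>t. h t - hk k t)) 0 < e" and k0: "k > 0"
    by (auto simp: eventually_sequentially)
  then have k: "L2_norm (\<lambda>t. f t - fk k t) * L2_norm h + L2_norm f * L2_norm (\<lambda>t. h t - hk k t) \<le> e"
    by (simp add: dist_real_def)
  have fkm[measurable]: "fk k \<in> borel_measurable borel" unfolding fk_def by measurable
  have hkm[measurable]: "hk k \<in> borel_measurable borel" unfolding hk_def by measurable
  have fk: "fk k \<in> L2" by (rule L2_mono[OF f fkm]) (auto simp: fk_def)
  have hk: "hk k \<in> L2" by (rule L2_mono[OF h hkm]) (auto simp: hk_def)
  have fkle: "L2_norm (fk k) \<le> L2_norm f" unfolding L2_norm_def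
    by (intro real_sqrt_le_mono integral_mono L2D(2) f fk) (auto simp: fk_def)
  have close: "dist (L2_inner (\<lambda>t. f (t + z)) h) (L2_inner (\<lambda>t. fk k (t + z)) (hk k)) \<le> e" for z
  proof -
    have "L2_inner (\<lambda>t. f (t + z)) h - L2_inner (\<lambda>t. fk k (t + z)) (hk k)
      = L2_inner (\<lambda>t. f (t + z) - fk k (t + z)) h + L2_inner (\<lambda>t. fk k (t + z)) (\<lambda>t. h t - hk k t)"
      by (simp add: L2_inner_diff L2_translate f fk h hk)
    also have "cmod \<dots> \<le> cmod (L2_inner (\<lambda>t. f (t + z) - fk k (t + z)) h) + cmod (L2_inner (\<lambda>t. fk k (t + z)) (\<lambda>t. h t - hk k t))"
      by (rule norm_triangle_ineq)
    also have "\<dots> \<le> L2_norm (\<lambda>t. f (t + z) - fk k (t + z)) * L2_norm h + L2_norm (\<lambda>t. fk k (t + z)) * L2_norm (\<lambda>t. h t - hk k t)"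
      by (intro add_mono L2_inner_integrable(2) L2_diff L2_translate f fk h hk)
    also have "\<dots> = L2_norm (\<lambda>t. f t - fk k t) * L2_norm h + L2_norm (fk k) * L2_norm (\<lambda>t. h t - hk k t)"
      by (simp add: L2_translate(2)[OF fk] L2_translate(2)[OF L2_diff[OF f fk]])
    also have "\<dots> \<le> L2_norm (\<lambda>t. f t - fk k t) * L2_norm h + L2_norm f * L2_norm (\<lambda>t. h t - hk k t)"
      by (intro add_mono mult_right_mono fkle L2_norm_nonneg order_refl)
    finally show ?thesis using k by (simp add: dist_norm)
  qed
  have "(\<lambda>n. L2_inner (\<lambda>t. fk k (t + y n)) (hk k)) \<longlonglongrightarrow> L2_inner (fk k) (hk k)"
    by (rule L2_inner_translate_tendsto_bounded[where M="real k"])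
      (use k0 y in \<open>auto simp: fk_def hk_def\<close>)
  then show "\<exists>G l. (\<forall>\<^sub>F n in sequentially. dist (L2_inner (\<lambda>t. f (t + y n)) h) (G n) \<le> e)
        \<and> dist (L2_inner f h) l \<le> e \<and> G \<longlonglongrightarrow> l"
    using close close[of 0] by (intro exI conjI) auto
qed

section \<open>The short-time Fourier transform with Gaussian window\<close>

lemma lborel_integral_prod_mult:
  fixes f :: "'a::euclidean_space \<Rightarrow> 'c::{real_normed_field, banach, second_countable_topology}"
    and g :: "'b::euclidean_space \<Rightarrow> 'c"
  assumes f: "integrable lborel f" and g: "integrable lborel g"
  shows "integrable lborel (\<lambda>z. f (fst z) * g (snd z))"
    and "(\<integral>z. f (fst z) * g (snd z) \<partial>lborel) = (\<integral>x. f x \<partial>lborel) * (\<integral>x. g x \<partial>lborel)"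
proof -
  note [measurable] = borel_measurable_integrable[OF f] borel_measurable_integrable[OF g]
  have int: "integrable (lborel \<Otimes>\<^sub>M lborel) (\<lambda>z. f (fst z) * g (snd z))"
    by (rule lborel_pair.Fubini_integrable) (auto simp: norm_mult f g intro!: integrable_mult_left integrable_norm)
  then show "integrable lborel (\<lambda>z. f (fst z) * g (snd z))"
    by (simp add: lborel_prod)
  show "(\<integral>z. f (fst z) * g (snd z) \<partial>lborel) = (\<integral>x. f x \<partial>lborel) * (\<integral>x. g x \<partial>lborel)"
    using lborel_pair.integral_fst'[OF int] by (simp add: lborel_prod)
qed

text \<open>For fixed \<open>u\<close> the map is a translation in \<open>y\<close>, so Tonelli and
  translation invariance show that it preserves Lebesgue measure.\<close>

lemma lborel_distr_shear:
  "distr lborel borel (\<lambda>(y, u). (u + y, u)) = (lborel :: ('a::euclidean_space \<times> 'a) measure)"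
proof (rule measure_eqI)
  fix A :: "('a \<times> 'a) set"
  assume "A \<in> sets (distr lborel borel (\<lambda>(y, u). (u + y, u)))"
  then have [measurable]: "A \<in> sets borel" "A \<in> sets (borel \<Otimes>\<^sub>M borel)" unfolding borel_prod by simp_all
  have [measurable]: "(\<lambda>(y, u). (u + y, u)) \<in> borel_measurable (borel :: ('a \<times> 'a) measure)"
    unfolding borel_prod[symmetric] by measurable
  have "emeasure (distr lborel borel (\<lambda>(y, u). (u + y, u))) A
      = (\<integral>\<^sup>+p. indicator A p \<partial>distr (lborel :: ('a \<times> 'a) measure) borel (\<lambda>(y, u). (u + y, u)))"
    by simp
  also have "\<dots> = (\<integral>\<^sup>+p. indicator A (snd p + fst p, snd p) \<partial>(lborel \<Otimes>\<^sub>M lborel))"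
    by (subst nn_integral_distr) (auto simp: lborel_prod split_beta)
  also have "\<dots> = (\<integral>\<^sup>+u. \<integral>\<^sup>+y. indicator A (u + y, u) \<partial>lborel \<partial>lborel)"
    by (subst lborel_pair.nn_integral_snd[symmetric]) (auto simp: borel_prod)
  also have "\<dots> = (\<integral>\<^sup>+u. \<integral>\<^sup>+t. indicator A (t, u) \<partial>lborel \<partial>lborel)"
  proof (rule nn_integral_cong)
    fix u :: 'a
    have "(\<lambda>t. indicator A (t, u) :: ennreal) \<in> borel_measurable borel"
      by (rule measurable_compose[of "\<lambda>t. (t, u)" _ borel]) (auto simp: borel_prod[symmetric])
    then show "(\<integral>\<^sup>+y. indicator A (u + y, u) \<partial>lborel) = (\<integral>\<^sup>+t. indicator A (t, u) \<partial>lborel)"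
      by (subst (2) nn_integral_lborel_affine[where t=u and c=1]) auto
  qed
  also have "\<dots> = (\<integral>\<^sup>+p. indicator A p \<partial>(lborel \<Otimes>\<^sub>M lborel))"
    by (rule lborel_pair.nn_integral_snd) (auto simp: borel_prod)
  finally show "emeasure (distr lborel borel (\<lambda>(y, u). (u + y, u))) A = emeasure lborel A"
    by (simp add: lborel_prod)
qed simp

lemma lborel_shear:
  fixes F :: "'a::euclidean_space \<times> 'a \<Rightarrow> 'b::{banach, second_countable_topology}"
  assumes [measurable]: "F \<in> borel_measurable borel"
  shows "integrable lborel (\<lambda>(y, u). F (u + y, u)) \<Longrightarrow> integrable lborel F"
    and "(\<integral>p. F p \<partial>lborel) = (\<integral>(y, u). F (u + y, u) \<partial>lborel)"
proof -
  have [measurable]: "(\<lambda>p. (snd p + fst p, snd p)) \<in> borel_measurable (borel :: ('a \<times> 'a) measure)"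
    unfolding borel_prod[symmetric] by measurable
  show "integrable lborel F" if "integrable lborel (\<lambda>(y, u). F (u + y, u))"
    using that by (subst lborel_distr_shear[symmetric], subst integrable_distr_eq) (auto simp: split_beta')
  show "(\<integral>p. F p \<partial>lborel) = (\<integral>(y, u). F (u + y, u) \<partial>lborel)"
    by (subst lborel_distr_shear[symmetric], subst integral_distr) (auto simp: split_beta')
qed

text \<open>In the coordinates \<open>t = u + y\<close> the kernel depends on \<open>y\<close>
  alone, and the integral over \<open>u\<close> is an inner product with a translate of
  \<open>f\<close>. Cauchy-Schwarz bounds its absolute version uniformly in \<open>y\<close>, so
  integrability of \<open>k\<close> gives absolute convergence.\<close>

lemma L2_convolution_form:
  fixes f h :: "real ^ 'd \<Rightarrow> complex" and k :: "real ^ 'd \<Rightarrow> real"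
  assumes f: "f \<in> L2" and h: "h \<in> L2" and k: "integrable lborel k"
  shows "integrable lborel (\<lambda>(t, u). f t * cnj (h u) * k (t - u))"
    and "(\<integral>(t, u). f t * cnj (h u) * k (t - u) \<partial>lborel) = (\<integral>y. k y * L2_inner (\<lambda>t. f (t + y)) h \<partial>lborel)"
proof -
  note [measurable] = L2D(1)[OF f] L2D(1)[OF h] borel_measurable_integrable[OF k, simplified]
  let ?F = "\<lambda>(t, u). f t * cnj (h u) * k (t - u)"
  let ?G = "\<lambda>(y, u). f (u + y) * cnj (h u) * k y"
  have Fm: "?F \<in> borel_measurable borel"
    unfolding borel_prod[symmetric] by measurable
  have G: "integrable (lborel \<Otimes>\<^sub>M lborel) ?G"
  proof (rule lborel_pair.Fubini_integrable)
    show "integrable lborel (\<lambda>y. \<integral>u. norm (?G (y, u)) \<partial>lborel)"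
    proof (rule Bochner_Integration.integrable_bound)
      show "integrable lborel (\<lambda>y. L2_norm f * L2_norm h * norm (k y))"
        using k by auto
      show "AE y in lborel. norm (\<integral>u. norm (?G (y, u)) \<partial>lborel) \<le> norm (L2_norm f * L2_norm h * norm (k y))"
      proof (rule AE_I2)
        fix y
        have "(\<integral>u. norm (?G (y, u)) \<partial>lborel) = (\<integral>u. cmod (f (u + y)) * cmod (h u) \<partial>lborel) * \<bar>k y\<bar>"
          by (simp add: norm_mult)
        also have "\<dots> \<le> L2_norm f * L2_norm h * \<bar>k y\<bar>"
          using L2_mult_integrable(2)[OF L2_translate(1)[OF f] h, of y] L2_translate(2)[OF f, of y]
          by (intro mult_right_mono) auto
        finally show "norm (\<integral>u. norm (?G (y, u)) \<partial>lborel) \<le> norm (L2_norm f * L2_norm h * norm (k y))"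
          using L2_norm_nonneg[of f] L2_norm_nonneg[of h] by (simp add: abs_mult)
      qed
    qed measurable
    show "AE y in lborel. integrable lborel (\<lambda>u. ?G (y, u))"
      using L2_inner_integrable(1)[OF L2_translate(1)[OF f] h] by (intro AE_I2) auto
  qed measurable
  have eq: "(\<lambda>(y, u). ?F (u + y, u)) = ?G" by auto
  have G': "integrable lborel (\<lambda>(y, u). ?F (u + y, u))"
    using G unfolding eq lborel_prod .
  show "integrable lborel ?F"
    by (rule lborel_shear(1)[OF Fm G'])
  have "(\<integral>p. ?F p \<partial>lborel) = (\<integral>p. ?G p \<partial>lborel)"
    unfolding lborel_shear(2)[OF Fm] eq ..
  also have "\<dots> = (\<integral>y. \<integral>u. ?G (y, u) \<partial>lborel \<partial>lborel)"
    using lborel_pair.integral_fst'[OF G] by (simp add: lborel_prod)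
  also have "\<dots> = (\<integral>y. k y * L2_inner (\<lambda>t. f (t + y)) h \<partial>lborel)"
    by (simp add: L2_inner_def mult.commute)
  finally show "(\<integral>(t, u). f t * cnj (h u) * k (t - u) \<partial>lborel) = (\<integral>y. k y * L2_inner (\<lambda>t. f (t + y)) h \<partial>lborel)" .
qed

text \<open>Squared \<open>L2\<close> norm of the Gaussian window, the constant in Moyal's identity.
  The type argument fixes the dimension.\<close>

definition gauss_energy :: "'d::finite itself \<Rightarrow> real" where
  "gauss_energy _ = (\<integral>x. (gauss (x :: real ^ 'd))\<^sup>2 \<partial>lborel)"

lemma gauss_square_integrable: "integrable lborel (\<lambda>x::real^'d. (gauss x)\<^sup>2)"
proof (rule Bochner_Integration.integrable_bound[OF gaussian_integral(1)])
  have "gauss x * gauss x \<le> 1 * gauss x" for x :: "real^'d"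
    by (intro mult_right_mono) (auto simp: gauss_le_1 gauss_pos less_imp_le)
  then show "AE x in lborel. norm ((gauss x)\<^sup>2) \<le> norm (gauss (x::real^'d))"
    by (intro AE_I2) (simp add: power2_eq_square gauss_pos less_imp_le)
qed measurable

lemma gauss_energy_pos: "0 < gauss_energy TYPE('d::finite)"
proof -
  have "gauss_energy TYPE('d) \<noteq> 0"
  proof
    assume "gauss_energy TYPE('d) = 0"
    then have "AE x in (lborel :: (real^'d) measure). (gauss x)\<^sup>2 = 0"
      unfolding gauss_energy_def
      by (subst (asm) integral_nonneg_eq_0_iff_AE[OF gauss_square_integrable]) auto
    then have "AE x in (lborel :: (real^'d) measure). False"
      by eventually_elim (use gauss_pos in \<open>auto simp: less_le\<close>)
    then show False
      by (simp add: AE_iff_null null_sets_def)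
  qed
  moreover have "0 \<le> gauss_energy TYPE('d)"
    unfolding gauss_energy_def by (intro integral_nonneg_AE) auto
  ultimately show ?thesis by simp
qed

text \<open>Completing the square about the midpoint of \<open>t\<close> and \<open>u\<close>
  confines the dependence on \<open>x\<close> to one factor.\<close>

lemma gauss_mult_shift:
  "gauss (t - x) * gauss (u - x) = gauss ((t - u) /\<^sub>R sqrt 2) * (gauss (x - (t + u) /\<^sub>R 2))\<^sup>2"
proof -
  have "(norm (t - x))\<^sup>2 + (norm (u - x))\<^sup>2 = (norm (t - u))\<^sup>2 / 2 + 2 * (norm (x - (t + u) /\<^sub>R 2))\<^sup>2"
    by (simp add: power2_norm_eq_inner inner_diff_left inner_diff_right inner_add_left inner_add_right inner_commute field_simps)
  moreover have "(norm ((t - u) /\<^sub>R sqrt 2))\<^sup>2 = (norm (t - u))\<^sup>2 / 2"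
    by (simp add: power_divide power_mult_distrib power_inverse)
  ultimately show ?thesis
    unfolding gauss_def power2_eq_square exp_add[symmetric] 
    by (simp add: algebra_simps flip: power2_eq_square distrib_left)
qed

text \<open>The integral is the autocorrelation of the window, which is again a Gaussian in
  \<open>t - u\<close>.\<close>

lemma gauss_mult_integral:
  fixes t u :: "real ^ 'd"
  shows "integrable lborel (\<lambda>x. gauss (t - x) * gauss (u - x))"
    and "(\<integral>x. gauss (t - x) * gauss (u - x) \<partial>lborel) = gauss ((t - u) /\<^sub>R sqrt 2) * gauss_energy TYPE('d)"
proof -
  let ?c = "- ((t + u) /\<^sub>R 2)"
  have eq: "gauss (t - x) * gauss (u - x) = gauss ((t - u) /\<^sub>R sqrt 2) * (gauss (?c + 1 *\<^sub>R x))\<^sup>2" for x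
    unfolding gauss_mult_shift by (simp add: algebra_simps)
  show "integrable lborel (\<lambda>x. gauss (t - x) * gauss (u - x))"
    unfolding eq using lborel_integrable_affine[OF gauss_square_integrable, of 1 ?c] by (intro integrable_mult_right) auto
  show "(\<integral>x. gauss (t - x) * gauss (u - x) \<partial>lborel) = gauss ((t - u) /\<^sub>R sqrt 2) * gauss_energy TYPE('d)"
    unfolding eq gauss_energy_def integral_mult_right_zero
    by (subst (2) lborel_integral_affine[where t="?c" and c=1]) auto
qed

section \<open>The transform as an integral and the damped Moyal identity\<close>

lemma exp_modulation: "exp (2 * of_real pi * \<i> * of_real r) = cis (2 * pi * r)"
  by (simp add: cis_conv_exp mult_ac)

lemma stft_gaussian_eq:
  "stft gaussian f (x, w) = (\<integral>t. f t * cis (2 * pi * (t \<bullet> (- w))) * gauss (t - x) \<partial>lborel)"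
  unfolding stft_def L2_inner_def tf_shift_def prod.case exp_modulation
  by (simp add: gaussian_def gauss_def cis_cnj mult.assoc)

lemma borel_measurable_stft [measurable]:
  assumes f: "f \<in> borel_measurable borel"
  shows "stft gaussian f \<in> borel_measurable borel"
proof -
  note [measurable] = f
  have "(\<lambda>z. \<integral>t. f t * cis (2 * pi * (t \<bullet> (- snd z))) * gauss (t - fst z) \<partial>lborel) \<in> borel_measurable (borel \<Otimes>\<^sub>M borel)"
    by measurable
  then show ?thesis
    unfolding borel_prod stft_gaussian_eq[symmetric] by simp
qed

text \<open>
  Without the factor \<open>gauss (a *\<^sub>R snd z)\<close> the fourfold integral does not converge absolutely. With it
  Fubini applies, and the frequency integral produces an approximate identity of width \<open>a\<close>.
\<close>

lemma stft_moyal_damped: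
  fixes f h :: "real ^ 'd \<Rightarrow> complex"
  assumes f: "f \<in> L2" and h: "h \<in> L2" and a: "a > 0"
  shows "integrable lborel (\<lambda>z. stft gaussian f z * cnj (stft gaussian h z) * gauss (a *\<^sub>R snd z))"
    and "(\<integral>z. stft gaussian f z * cnj (stft gaussian h z) * gauss (a *\<^sub>R snd z) \<partial>lborel)
      = gauss_energy TYPE('d) *
        (\<integral>v. gauss (a *\<^sub>R v /\<^sub>R sqrt 2) * gauss v * L2_inner (\<lambda>t. f (t + a *\<^sub>R v)) h \<partial>lborel)"
proof -
  note [measurable] = L2D(1)[OF f] L2D(1)[OF h]
  let ?E = "gauss_energy TYPE('d)"
  \<comment> \<open>Integrand of the fourfold integral, with \<open>p = (t, u)\<close> the variables
    of the two transforms and \<open>z = (x, w)\<close> the phase space point. The grouping exhibits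
    a function of \<open>x\<close> times a function of \<open>w\<close>.\<close>
  define F where "F p z = (f (fst p) * cnj (h (snd p))) *
      (of_real (gauss (fst p - fst z) * gauss (snd p - fst z)) *
      (cis (2 * pi * ((snd p - fst p) \<bullet> snd z)) * gauss (a *\<^sub>R snd z)))"
    for p z :: "'d phase"
  \<comment> \<open>The integral of \<open>F\<close> over \<open>z\<close> without the factors from
    \<open>f\<close> and \<open>h\<close>: autocorrelation of the window times the Fourier transform
    of the damping factor, at \<open>y = t - u\<close>.\<close>
  define k where "k y = gauss (y /\<^sub>R sqrt 2) * ?E * (gauss (y /\<^sub>R a) / a ^ CARD('d))" for y :: "real ^ 'd"
  have km [measurable]: "k \<in> borel_measurable borel"
    unfolding k_def by measurable
  have kint: "integrable lborel k"
  proof (rule Bochner_Integration.integrable_bound)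
    show "integrable lborel (\<lambda>y::real^'d. ?E / a ^ CARD('d) * gauss (0 + (1 / a) *\<^sub>R y))"
      using a by (intro integrable_mult_right lborel_integrable_affine gaussian_integral) auto
    have "gauss (y /\<^sub>R sqrt 2) * (?E * gauss (y /\<^sub>R a)) \<le> 1 * (?E * gauss (y /\<^sub>R a))" for y :: "real ^ 'd"
      by (intro mult_right_mono gauss_le_1) (auto simp: gauss_pos gauss_energy_pos less_imp_le)
    then show "AE y in lborel. norm (k y) \<le> norm (?E / a ^ CARD('d) * gauss (0 + (1 / a) *\<^sub>R y))"
      using a by (intro AE_I2)
        (simp add: k_def abs_mult gauss_pos gauss_energy_pos less_imp_le divide_right_mono divide_inverse mult_ac)
  qed measurable
  have inner: "integrable lborel (F p)"
    "(\<integral>z. F p z \<partial>lborel) = f (fst p) * cnj (h (snd p)) * k (fst p - snd p)" for p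
  proof -
    have i1: "integrable lborel (\<lambda>x. complex_of_real (gauss (fst p - x) * gauss (snd p - x)))"
      by (intro integrable_of_real gauss_mult_integral)
    note i2 = gaussian_fourier_scaled(1)[OF a, of "snd p - fst p"]
    show "integrable lborel (F p)"
      unfolding F_def by (intro integrable_mult_right lborel_integral_prod_mult(1)[OF i1 i2])
    show "(\<integral>z. F p z \<partial>lborel) = f (fst p) * cnj (h (snd p)) * k (fst p - snd p)"
      unfolding F_def integral_mult_right_zero lborel_integral_prod_mult(2)[OF i1 i2] integral_complex_of_real
        gauss_mult_integral gaussian_fourier_scaled(2)[OF a] k_def
      using gauss_minus[of "(fst p - snd p) /\<^sub>R a"] by (simp flip: scaleR_minus_right)
  qed
  \<comment> \<open>Taking the modulus removes the oscillation, so the frequency integral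
    contributes only \<open>1 / a ^ CARD('d)\<close> and the decay in \<open>t - u\<close> comes
    from the autocorrelation. The right-hand side has the shape of the integrand in
    \<open>L2_convolution_form\<close> for the moduli of \<open>f\<close> and
    \<open>h\<close>.\<close>
  have innerN: "(\<integral>z. norm (F p z) \<partial>lborel) \<le> norm (of_real (cmod (f (fst p))) * cnj (of_real (cmod (h (snd p)))) * complex_of_real (gauss ((fst p - snd p) /\<^sub>R sqrt 2) * ?E / a ^ CARD('d)))" for p
  proof -
    have i1: "integrable lborel (\<lambda>x. gauss (fst p - x) * gauss (snd p - x))"
      by (intro gauss_mult_integral)
    have i2: "integrable lborel (\<lambda>w::real^'d. gauss (0 + a *\<^sub>R w))"
      using a by (intro lborel_integrable_affine gaussian_integral) auto
    have g1: "(\<integral>w. gauss (0 + a *\<^sub>R w) \<partial>(lborel :: (real^'d) measure)) = 1 / a ^ CARD('d)"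
      using lborel_integral_affine[of "gauss :: real^'d \<Rightarrow> real" a 0] a gaussian_integral(2)[where 'a="real^'d"]
      by (simp add: field_simps)
    have "norm (F p z) = cmod (f (fst p)) * cmod (h (snd p)) *
      ((gauss (fst p - fst z) * gauss (snd p - fst z)) * gauss (0 + a *\<^sub>R snd z))" for z
      by (simp add: F_def norm_mult gauss_pos less_imp_le)
    then have "(\<integral>z. norm (F p z) \<partial>lborel) = cmod (f (fst p)) * cmod (h (snd p)) * (gauss ((fst p - snd p) /\<^sub>R sqrt 2) * ?E * (1 / a ^ CARD('d)))"
      using lborel_integral_prod_mult(2)[OF i1 i2] by (simp only: integral_mult_right_zero gauss_mult_integral g1)
    then show ?thesis
      using a by (simp add: norm_mult norm_divide norm_power gauss_pos gauss_energy_pos less_imp_le)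
  qed
  have Fm: "(\<lambda>q. F (fst q) (snd q)) \<in> borel_measurable (borel \<Otimes>\<^sub>M borel)"
    unfolding F_def borel_prod[symmetric] by measurable
  have absL2: "(\<lambda>t. complex_of_real (cmod (f t))) \<in> L2" "(\<lambda>t. complex_of_real (cmod (h t))) \<in> L2"
    using L2D(2)[OF f] L2D(2)[OF h] by (auto intro!: L2I)
  have g2: "integrable lborel (\<lambda>y::real^'d. gauss (y /\<^sub>R sqrt 2) * ?E / a ^ CARD('d))"
    using lborel_integrable_affine[OF gaussian_integral(1)[where 'a="real^'d"], of "inverse (sqrt 2)" 0]
    by (intro integrable_divide_zero integrable_mult_left) auto
  have Fint: "integrable (lborel \<Otimes>\<^sub>M lborel) (\<lambda>(p, z). F p z)"
  proof (rule lborel_pair.Fubini_integrable)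
    show "integrable lborel (\<lambda>p. \<integral>z. norm (case (p, z) of (p, z) \<Rightarrow> F p z) \<partial>lborel)"
    proof (rule Bochner_Integration.integrable_bound[OF L2_convolution_form(1)[OF absL2 g2]])
      show "AE p in lborel. norm (\<integral>z. norm (case (p, z) of (p, z) \<Rightarrow> F p z) \<partial>lborel)
        \<le> norm (case p of (t, u) \<Rightarrow> of_real (cmod (f t)) * cnj (of_real (cmod (h u))) * complex_of_real (gauss ((t - u) /\<^sub>R sqrt 2) * ?E / a ^ CARD('d)))"
        using innerN by (intro AE_I2) (simp add: split_beta abs_of_nonneg integral_nonneg_AE)
    qed (use Fm in \<open>simp add: split_beta'\<close>)
  qed (use Fm inner in \<open>simp_all add: split_beta'\<close>)
  \<comment> \<open>In the other order of integration the variables \<open>t\<close> and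
    \<open>u\<close> decouple for fixed \<open>z\<close>, and the two transforms appear.\<close>
  have outer: "(\<integral>p. F p z \<partial>lborel) = stft gaussian f z * cnj (stft gaussian h z) * gauss (a *\<^sub>R snd z)" for z
  proof -
    let ?f = "\<lambda>t. f t * cis (2 * pi * (t \<bullet> (- snd z))) * gauss (t - fst z)"
    let ?h = "\<lambda>t. h t * cis (2 * pi * (t \<bullet> (- snd z))) * gauss (t - fst z)"
    have gL2: "(\<lambda>t. complex_of_real (gauss (t - fst z))) \<in> L2"
      using lborel_integrable_affine[OF gauss_square_integrable, of 1 "- fst z"]
      by (intro L2I) (auto simp: gauss_pos less_imp_le)
    have fi: "integrable lborel ?f"
      by (rule Bochner_Integration.integrable_bound[OF L2_inner_integrable(1)[OF f gL2]]) (auto simp: norm_mult)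
    have hi: "integrable lborel ?h"
      by (rule Bochner_Integration.integrable_bound[OF L2_inner_integrable(1)[OF h gL2]]) (auto simp: norm_mult)
    have "F p z = (?f (fst p) * cnj (?h (snd p))) * gauss (a *\<^sub>R snd z)" for p
    proof -
      have "cis (2 * pi * ((snd p - fst p) \<bullet> snd z))
        = cis (2 * pi * (fst p \<bullet> (- snd z))) * cnj (cis (2 * pi * (snd p \<bullet> (- snd z))))"
        by (simp add: cis_cnj cis_mult algebra_simps)
      then show ?thesis unfolding F_def by simp
    qed
    then have "(\<integral>p. F p z \<partial>lborel) = (\<integral>t. ?f t \<partial>lborel) * (\<integral>t. cnj (?h t) \<partial>lborel) * gauss (a *\<^sub>R snd z)"
      by (simp only: integral_mult_left_zero lborel_integral_prod_mult(2)[OF fi integrable_cnj[OF hi]])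
    also have "(\<integral>t. cnj (?h t) \<partial>lborel) = cnj (\<integral>t. ?h t \<partial>lborel)"
      by (rule Bochner_Integration.integral_cnj)
    finally show ?thesis
      by (cases z) (simp only: stft_gaussian_eq fst_conv snd_conv)
  qed
  show "integrable lborel (\<lambda>z. stft gaussian f z * cnj (stft gaussian h z) * gauss (a *\<^sub>R snd z))"
    using lborel_pair.integrable_snd[OF Fint] by (simp only: outer)
  have "(\<integral>z. stft gaussian f z * cnj (stft gaussian h z) * gauss (a *\<^sub>R snd z) \<partial>lborel)
      = (\<integral>p. f (fst p) * cnj (h (snd p)) * k (fst p - snd p) \<partial>lborel)"
    using lborel_pair.Fubini_integral[OF Fint] by (simp only: outer inner)
  also have "\<dots> = (\<integral>y. k y * L2_inner (\<lambda>t. f (t + y)) h \<partial>lborel)"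
    using L2_convolution_form(2)[OF f h kint] by (simp only: split_beta')
  \<comment> \<open>Substituting \<open>y = a *\<^sub>R v\<close> produces the factor
    \<open>a ^ CARD('d)\<close>, which cancels the denominator in \<open>k\<close>; what remains
    stays bounded as \<open>a\<close> tends to 0.\<close>
  also have "\<dots> = a ^ CARD('d) *\<^sub>R (\<integral>v. k (0 + a *\<^sub>R v) * L2_inner (\<lambda>t. f (t + (0 + a *\<^sub>R v))) h \<partial>lborel)"
  proof -
    have "(\<lambda>y. L2_inner (\<lambda>t. f (t + y)) h) \<in> borel_measurable borel"
      unfolding L2_inner_def by measurable
    then show ?thesis
      using a by (subst lborel_integral_affine[where c=a and t=0]) auto
  qed
  also have "\<dots> = ?E * (\<integral>v. gauss (a *\<^sub>R v /\<^sub>R sqrt 2) * gauss v * L2_inner (\<lambda>t. f (t + a *\<^sub>R v)) h \<partial>lborel)"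
    unfolding integral_mult_right_zero[symmetric] integral_scaleR_right[symmetric]
    using a by (intro Bochner_Integration.integral_cong) (auto simp: k_def scaleR_conv_of_real[where 'a=complex])
  finally show "(\<integral>z. stft gaussian f z * cnj (stft gaussian h z) * gauss (a *\<^sub>R snd z) \<partial>lborel)
      = ?E * (\<integral>v. gauss (a *\<^sub>R v /\<^sub>R sqrt 2) * gauss v * L2_inner (\<lambda>t. f (t + a *\<^sub>R v)) h \<partial>lborel)" .
qed

text \<open>For \<open>h = f\<close> the right-hand side of the damped identity is bounded uniformly
  in the width, since \<open>gauss\<close> has integral 1 and values at most 1. Fatou's lemma
  removes the damping.\<close>

lemma stft_norm_bound:
  fixes f :: "real ^ 'd \<Rightarrow> complex"
  assumes f: "f \<in> L2"
  shows "(\<integral>\<^sup>+z. (cmod (stft gaussian f z))\<^sup>2 \<partial>lborel) \<le> ennreal (gauss_energy TYPE('d) * (L2_norm f)\<^sup>2)"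
proof -
  note [measurable] = L2D(1)[OF f]
  let ?E = "gauss_energy TYPE('d)"
  define a where "a n = 1 / real (Suc n)" for n
  have a0: "a n > 0" for n by (simp add: a_def)
  have alim: "a \<longlonglongrightarrow> 0" unfolding a_def by (rule lim_inverse_n'[THEN filterlim_sequentially_Suc[THEN iffD2]])
  define S where "S n z = (cmod (stft gaussian f z))\<^sup>2 * gauss (a n *\<^sub>R snd z)" for n z
  have Seq: "of_real (S n z) = stft gaussian f z * cnj (stft gaussian f z) * gauss (a n *\<^sub>R snd z)" for n z
    by (simp add: S_def flip: complex_norm_square)
  have Sint: "integrable lborel (S n)" for n
    using stft_moyal_damped(1)[OF f f a0, of n] unfolding Seq[symmetric] complex_of_real_integrable_eq .
  have bound: "(\<integral>\<^sup>+z. S n z \<partial>lborel) \<le> ennreal (?E * (L2_norm f)\<^sup>2)" for n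
  proof -
    have S0: "0 \<le> S n z" for z by (simp add: S_def gauss_pos less_imp_le)
    have "(\<integral>z. S n z \<partial>lborel) = cmod (\<integral>z. of_real (S n z) \<partial>lborel)"
      unfolding integral_complex_of_real norm_of_real using S0 by (simp add: integral_nonneg_AE)
    also have "\<dots> = ?E * cmod (\<integral>v. gauss (a n *\<^sub>R v /\<^sub>R sqrt 2) * gauss v * L2_inner (\<lambda>t. f (t + a n *\<^sub>R v)) f \<partial>lborel)"
      unfolding Seq stft_moyal_damped(2)[OF f f a0] norm_mult norm_of_real using gauss_energy_pos[where 'd='d] by simp
    also have "cmod (\<integral>v. gauss (a n *\<^sub>R v /\<^sub>R sqrt 2) * gauss v * L2_inner (\<lambda>t. f (t + a n *\<^sub>R v)) f \<partial>lborel)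
      \<le> (\<integral>v. gauss v * (L2_norm f)\<^sup>2 \<partial>(lborel :: (real^'d) measure))"
    proof (rule order_trans[OF integral_norm_bound integral_mono'])
      show "integrable lborel (\<lambda>v::real^'d. gauss v * (L2_norm f)\<^sup>2)"
        by (intro integrable_mult_left gaussian_integral)
      show "0 \<le> gauss v * (L2_norm f)\<^sup>2" for v :: "real ^ 'd" by (simp add: gauss_pos less_imp_le)
      show "norm (gauss (a n *\<^sub>R v /\<^sub>R sqrt 2) * gauss v * L2_inner (\<lambda>t. f (t + a n *\<^sub>R v)) f) \<le> gauss v * (L2_norm f)\<^sup>2" for v
      proof -
        have "cmod (L2_inner (\<lambda>t. f (t + a n *\<^sub>R v)) f) \<le> (L2_norm f)\<^sup>2"
          using L2_inner_integrable(2)[OF L2_translate(1)[OF f] f] by (simp add: L2_translate(2)[OF f] power2_eq_square)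
        then have "gauss (a n *\<^sub>R v /\<^sub>R sqrt 2) * (gauss v * cmod (L2_inner (\<lambda>t. f (t + a n *\<^sub>R v)) f)) \<le> 1 * (gauss v * (L2_norm f)\<^sup>2)"
          by (intro mult_mono) (auto simp: gauss_le_1 gauss_pos less_imp_le)
        then show ?thesis by (simp add: norm_mult gauss_pos less_imp_le mult.assoc)
      qed
    qed
    also have "\<dots> = (L2_norm f)\<^sup>2"
      using gaussian_integral(2)[where 'a="real^'d"] by simp
    finally have "(\<integral>z. S n z \<partial>lborel) \<le> ?E * (L2_norm f)\<^sup>2"
      using gauss_energy_pos[where 'd='d] by simp
    then show ?thesis
      using nn_integral_eq_integral[OF Sint[of n]] S0 by (simp add: ennreal_leI)
  qed
  have "(\<integral>\<^sup>+z. (cmod (stft gaussian f z))\<^sup>2 \<partial>lborel) = (\<integral>\<^sup>+z. liminf (\<lambda>n. ennreal (S n z)) \<partial>lborel)"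
  proof (rule nn_integral_cong)
    fix z :: "'d phase"
    have "(\<lambda>n. gauss (a n *\<^sub>R snd z)) \<longlonglongrightarrow> gauss (0 *\<^sub>R snd z)"
      unfolding gauss_def by (intro tendsto_intros alim)
    then have "(\<lambda>n. S n z) \<longlonglongrightarrow> (cmod (stft gaussian f z))\<^sup>2 * gauss (0 *\<^sub>R snd z)"
      unfolding S_def by (intro tendsto_intros)
    then have "(\<lambda>n. ennreal (S n z)) \<longlonglongrightarrow> ennreal ((cmod (stft gaussian f z))\<^sup>2)"
      by (intro tendsto_ennrealI) (simp add: gauss_def)
    then show "ennreal ((cmod (stft gaussian f z))\<^sup>2) = liminf (\<lambda>n. ennreal (S n z))"
      by (simp add: lim_imp_Liminf)
  qed
  also have "\<dots> \<le> liminf (\<lambda>n. \<integral>\<^sup>+z. S n z \<partial>lborel)"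
    using Sint by (intro nn_integral_liminf) auto
  also have "\<dots> \<le> liminf (\<lambda>n. ennreal (?E * (L2_norm f)\<^sup>2))"
    using bound by (intro Liminf_mono) auto
  finally show ?thesis by (simp add: Liminf_const)
qed

text \<open>On the right of the damped identity, dominated convergence and weak continuity of
  translations produce the inner product in the limit. On the left, the damping factor is at most 1,
  so the undamped integral of the moduli is a bound for every width.\<close>

lemma L2_inner_le_stft:
  fixes f h :: "real ^ 'd \<Rightarrow> complex"
  assumes f: "f \<in> L2" and h: "h \<in> L2"
  shows "ennreal (gauss_energy TYPE('d) * cmod (L2_inner f h))
    \<le> (\<integral>\<^sup>+z. ennreal (cmod (stft gaussian f z)) * ennreal (cmod (stft gaussian h z)) \<partial>lborel)"
proof -
  note [measurable] = L2D(1)[OF f] L2D(1)[OF h]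
  let ?E = "gauss_energy TYPE('d)"
  define a where "a n = 1 / real (Suc n)" for n
  have a0: "a n > 0" for n by (simp add: a_def)
  have alim: "a \<longlonglongrightarrow> 0" unfolding a_def by (rule lim_inverse_n'[THEN filterlim_sequentially_Suc[THEN iffD2]])
  define c where "c n v = gauss (a n *\<^sub>R v /\<^sub>R sqrt 2) * gauss v * L2_inner (\<lambda>t. f (t + a n *\<^sub>R v)) h" for n v
  have cm [measurable]: "c n \<in> borel_measurable borel" for n
    unfolding c_def L2_inner_def by measurable
  have "(\<lambda>n. \<integral>v. c n v \<partial>lborel) \<longlonglongrightarrow> (\<integral>v. gauss v * L2_inner f h \<partial>(lborel :: (real^'d) measure))"
  proof (rule integral_dominated_convergence)
    show "integrable lborel (\<lambda>v::real^'d. gauss v * (L2_norm f * L2_norm h))"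
      by (intro integrable_mult_left gaussian_integral)
    show "AE v in lborel. (\<lambda>n. c n v) \<longlonglongrightarrow> gauss v * L2_inner f h"
    proof (rule AE_I2)
      fix v :: "real ^ 'd"
      have av: "(\<lambda>n. a n *\<^sub>R v) \<longlonglongrightarrow> 0" using tendsto_scaleR[OF alim tendsto_const[of v]] by simp
      have "(\<lambda>n. gauss (a n *\<^sub>R v /\<^sub>R sqrt 2)) \<longlonglongrightarrow> gauss (0 *\<^sub>R v /\<^sub>R sqrt 2)"
        unfolding gauss_def by (intro tendsto_intros alim) auto
      then have "(\<lambda>n. c n v) \<longlonglongrightarrow> gauss (0 *\<^sub>R v /\<^sub>R sqrt 2) * gauss v * L2_inner f h"
        unfolding c_def by (intro tendsto_intros L2_inner_translate_tendsto f h av)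
      then show "(\<lambda>n. c n v) \<longlonglongrightarrow> gauss v * L2_inner f h"
        by (simp add: gauss_def)
    qed
    show "AE v in lborel. norm (c n v) \<le> gauss v * (L2_norm f * L2_norm h)" for n
    proof (rule AE_I2)
      fix v :: "real ^ 'd"
      have "cmod (L2_inner (\<lambda>t. f (t + a n *\<^sub>R v)) h) \<le> L2_norm f * L2_norm h"
        using L2_inner_integrable(2)[OF L2_translate(1)[OF f] h] by (simp add: L2_translate(2)[OF f])
      then have "gauss (a n *\<^sub>R v /\<^sub>R sqrt 2) * (gauss v * cmod (L2_inner (\<lambda>t. f (t + a n *\<^sub>R v)) h)) \<le> 1 * (gauss v * (L2_norm f * L2_norm h))"
        by (intro mult_mono) (auto simp: gauss_le_1 gauss_pos less_imp_le L2_norm_nonneg)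
      then show "norm (c n v) \<le> gauss v * (L2_norm f * L2_norm h)"
        by (simp add: c_def norm_mult gauss_pos less_imp_le mult.assoc)
    qed
  qed measurable
  moreover have "(\<integral>v. complex_of_real (gauss v) * L2_inner f h \<partial>(lborel :: (real^'d) measure)) = L2_inner f h"
    using gaussian_integral(2)[where 'a="real^'d"] by (simp add: integral_complex_of_real)
  ultimately have "(\<lambda>n. \<integral>v. c n v \<partial>lborel) \<longlonglongrightarrow> L2_inner f h" by (simp only:)
  then have lim: "(\<lambda>n. ennreal (?E * cmod (\<integral>v. c n v \<partial>lborel))) \<longlonglongrightarrow> ennreal (?E * cmod (L2_inner f h))"
    by (intro tendsto_intros)
  show ?thesis
  proof (rule Lim_bounded[OF lim], intro allI impI)
    fix n :: nat
    have "?E * cmod (\<integral>v. c n v \<partial>lborel) = cmod (\<integral>z. stft gaussian f z * cnj (stft gaussian h z) * gauss (a n *\<^sub>R snd z) \<partial>lborel)"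
      unfolding stft_moyal_damped(2)[OF f h a0] c_def norm_mult norm_of_real using gauss_energy_pos[where 'd='d] by simp
    then have "ennreal (?E * cmod (\<integral>v. c n v \<partial>lborel)) \<le> (\<integral>\<^sup>+z. norm (stft gaussian f z * cnj (stft gaussian h z) * gauss (a n *\<^sub>R snd z)) \<partial>lborel)"
      using integral_norm_bound_ennreal[OF stft_moyal_damped(1)[OF f h a0, of n]] by simp
    also have "\<dots> \<le> (\<integral>\<^sup>+z. ennreal (cmod (stft gaussian f z)) * ennreal (cmod (stft gaussian h z)) \<partial>lborel)"
    proof (intro nn_integral_mono)
      fix z
      have "norm (stft gaussian f z * cnj (stft gaussian h z) * gauss (a n *\<^sub>R snd z)) \<le> cmod (stft gaussian f z) * cmod (stft gaussian h z) * 1"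
        unfolding norm_mult complex_mod_cnj norm_of_real
        by (intro mult_left_mono) (auto simp: gauss_le_1 gauss_pos less_imp_le)
      then show "ennreal (norm (stft gaussian f z * cnj (stft gaussian h z) * gauss (a n *\<^sub>R snd z)))
          \<le> ennreal (cmod (stft gaussian f z)) * ennreal (cmod (stft gaussian h z))"
        by (simp add: ennreal_leI flip: ennreal_mult)
    qed
    finally show "ennreal (?E * cmod (\<integral>v. c n v \<partial>lborel)) \<le> (\<integral>\<^sup>+z. ennreal (cmod (stft gaussian f z)) * ennreal (cmod (stft gaussian h z)) \<partial>lborel)" .
  qed
qed

section \<open>Time-frequency shifts and covariance of the transform\<close>

lemma tf_shift_L2:
  assumes g: "g \<in> L2"
  shows "tf_shift l g \<in> L2"
proof -
  obtain x w where l: "l = (x, w)" by (cases l)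
  note [measurable] = L2D(1)[OF g]
  have eq: "tf_shift l g t = cis (2 * pi * (t \<bullet> w)) * g (t - x)" for t
    by (simp only: l tf_shift_def prod.case exp_modulation)
  show ?thesis
    by (rule L2_mono[OF L2_translate(1)[OF g, of "- x"]]) (auto simp: eq[abs_def] norm_mult)
qed

text \<open>After the translation \<open>t = x0 + t'\<close> the two modulations combine to the
  modulation by \<open>w - w0\<close> and a constant phase of modulus 1.\<close>

lemma stft_tf_shift:
  assumes [measurable]: "g \<in> borel_measurable borel"
  shows "cmod (stft gaussian (tf_shift l g) z) = cmod (stft gaussian g (z - l))"
proof -
  obtain x0 w0 where l: "l = (x0, w0)" by (cases l)
  obtain x w where z: "z = (x, w)" by (cases z)
  have eq: "tf_shift l g t = cis (2 * pi * (t \<bullet> w0)) * g (t - x0)" for t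
    by (simp only: l tf_shift_def prod.case exp_modulation)
  have "stft gaussian (tf_shift l g) z
    = (\<integral>t. cis (2 * pi * ((x0 + 1 *\<^sub>R t) \<bullet> w0)) * g ((x0 + 1 *\<^sub>R t) - x0) * cis (2 * pi * ((x0 + 1 *\<^sub>R t) \<bullet> (- w))) * gauss ((x0 + 1 *\<^sub>R t) - x) \<partial>lborel)"
    unfolding z stft_gaussian_eq eq by (subst lborel_integral_affine[where t=x0 and c=1]) auto
  also have "\<dots> = (\<integral>t. cis (2 * pi * (x0 \<bullet> (w0 - w))) * (g t * cis (2 * pi * (t \<bullet> (- (w - w0)))) * gauss (t - (x - x0))) \<partial>lborel)"
  proof (intro Bochner_Integration.integral_cong refl)
    fix t
    have "cis (2 * pi * ((x0 + t) \<bullet> w0)) * cis (2 * pi * ((x0 + t) \<bullet> (- w)))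
      = cis (2 * pi * (x0 \<bullet> (w0 - w))) * cis (2 * pi * (t \<bullet> (- (w - w0))))"
      by (simp add: cis_mult algebra_simps)
    moreover have "x0 + t - x = t - (x - x0)" by simp
    ultimately show "cis (2 * pi * ((x0 + 1 *\<^sub>R t) \<bullet> w0)) * g ((x0 + 1 *\<^sub>R t) - x0) * cis (2 * pi * ((x0 + 1 *\<^sub>R t) \<bullet> (- w))) * gauss ((x0 + 1 *\<^sub>R t) - x)
      = cis (2 * pi * (x0 \<bullet> (w0 - w))) * (g t * cis (2 * pi * (t \<bullet> (- (w - w0)))) * gauss (t - (x - x0)))"
      by (simp only: scaleR_one add_diff_cancel_left' mult_ac)
  qed
  also have "\<dots> = cis (2 * pi * (x0 \<bullet> (w0 - w))) * stft gaussian g (z - l)"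
    unfolding z l minus_prod_def fst_conv snd_conv stft_gaussian_eq by (rule integral_mult_right_zero)
  finally show ?thesis by (simp add: norm_mult)
qed

section \<open>Polynomially decaying weights and separated sets\<close>

text \<open>The single term belonging to the least \<open>k\<close> with
  \<open>norm z < 2 ^ k\<close> already dominates the left-hand side.\<close>

lemma decay_le_dyadic:
  fixes z :: "'a::real_normed_vector"
  assumes s: "s > 0"
  shows "ennreal ((1 + (norm z)\<^sup>2) powr (- s / 2))
    \<le> (\<Sum>k. ennreal (2 powr s * (2 powr (- s)) ^ k) * indicator (ball 0 (2 ^ k)) z)"
proof -
  define k where "k = (LEAST k. norm z < 2 ^ k)"
  have single: "f k \<le> (\<Sum>k. f k)" for f :: "nat \<Rightarrow> ennreal" and k
    using sum_le_suminf[of f "{k}"] by simp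
  have "\<exists>k. norm z < 2 ^ k" by (rule real_arch_pow) simp
  then have k: "norm z < 2 ^ k" unfolding k_def by (rule LeastI_ex)
  have "(1 + (norm z)\<^sup>2) powr (- s / 2) \<le> 2 powr s * (2 powr (- s)) ^ k"
  proof (cases k)
    case 0
    have "(1 + (norm z)\<^sup>2) powr (- s / 2) \<le> 1 powr (- s / 2)"
      using s by (intro powr_mono2') auto
    also have "\<dots> \<le> 2 powr s" using s by (simp add: ge_one_powr_ge_zero)
    finally show ?thesis using 0 by simp
  next
    case (Suc j)
    \<comment> \<open>Minimality gives a lower bound with exponent \<open>j = k - 1\<close>; the
      factor \<open>2 powr s\<close> pays for this shift.\<close>
    then have "\<not> norm z < 2 ^ j" unfolding k_def by (metis lessI not_less_Least)
    then have "(2 ^ j)\<^sup>2 \<le> (norm z)\<^sup>2" by (intro power_mono) auto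
    then have "(2 ^ j)\<^sup>2 \<le> 1 + (norm z)\<^sup>2" by linarith
    then have "(1 + (norm z)\<^sup>2) powr (- s / 2) \<le> ((2 ^ j)\<^sup>2) powr (- s / 2)"
      using s by (intro powr_mono2') auto
    also have "\<dots> = 2 powr s * (2 powr (- s)) ^ k"
    proof -
      have "(2::real) powr (2 * real j) = 2 powr real (2 * j)" by simp
      also have "\<dots> = (2 ^ j)\<^sup>2" by (simp only: powr_realpow zero_less_numeral power_even_eq)
      finally have "((2 ^ j)\<^sup>2) powr (- s / 2) = (2 powr (2 * real j)) powr (- s / 2)" by (simp only:)
      also have "\<dots> = 2 powr (- s * real j)"
        by (simp add: powr_powr mult.commute)
      also have "\<dots> = (2 powr (- s)) ^ j"
        by (simp add: powr_power mult.commute)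
      also have "\<dots> = 2 powr s * (2 powr (- s)) ^ k"
        by (simp add: Suc powr_minus)
      finally show ?thesis .
    qed
    finally show ?thesis .
  qed
  then have "ennreal ((1 + (norm z)\<^sup>2) powr (- s / 2))
      \<le> ennreal (2 powr s * (2 powr (- s)) ^ k) * indicator (ball 0 (2 ^ k)) z"
    using k by (simp add: ennreal_leI)
  also have "\<dots> \<le> (\<Sum>k. ennreal (2 powr s * (2 powr (- s)) ^ k) * indicator (ball 0 (2 ^ k)) z)"
    by (rule single)
  finally show ?thesis .
qed

text \<open>With \<open>n\<close> the dimension, the dyadic balls have volume proportional to
  \<open>2 ^ (k * n)\<close>. The dyadic sum thus integrates to a geometric series with ratio
  \<open>q = 2 powr (n - s)\<close>, which is smaller than 1 because \<open>s > n\<close>.\<close>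

lemma decay_nn_integral_finite:
  assumes s: "s > real DIM('a::euclidean_space)"
  shows "(\<integral>\<^sup>+z. ennreal ((1 + (norm (z::'a))\<^sup>2) powr (- s / 2)) \<partial>lborel) < \<infinity>"
proof -
  let ?n = "DIM('a)"
  let ?V = "unit_ball_vol (real ?n)"
  have [measurable]: "ball (c::'a) r \<in> sets borel" for c r by simp
  define q where "q = 2 powr (- s) * 2 ^ ?n"
  have q: "0 \<le> q" "q < 1"
  proof -
    have "q = 2 powr (real ?n - s)" by (simp add: q_def powr_diff powr_minus powr_realpow divide_inverse)
    then show "q < 1" using s powr_less_mono[of "real ?n - s" 0 2] by simp
  qed (simp add: q_def)
  have "(\<integral>\<^sup>+z. ennreal ((1 + (norm (z::'a))\<^sup>2) powr (- s / 2)) \<partial>lborel)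
    \<le> (\<integral>\<^sup>+z. (\<Sum>k. ennreal (2 powr s * (2 powr (- s)) ^ k) * indicator (ball (0::'a) (2 ^ k)) z) \<partial>lborel)"
    using le_less_trans[OF of_nat_0_le_iff s] by (intro nn_integral_mono decay_le_dyadic)
  also have "\<dots> = (\<Sum>k. \<integral>\<^sup>+z. ennreal (2 powr s * (2 powr (- s)) ^ k) * indicator (ball (0::'a) (2 ^ k)) z \<partial>lborel)"
    by (rule nn_integral_suminf) measurable
  also have "\<dots> = (\<Sum>k. ennreal (2 powr s * ?V * q ^ k))"
  proof (intro suminf_cong)
    fix k
    have "(\<integral>\<^sup>+z. ennreal (2 powr s * (2 powr (- s)) ^ k) * indicator (ball (0::'a) (2 ^ k)) z \<partial>lborel)
      = ennreal (2 powr s * (2 powr (- s)) ^ k) * ennreal (?V * (2 ^ k) ^ ?n)"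
      by (simp add: nn_integral_cmult_indicator emeasure_ball)
    also have "\<dots> = ennreal (2 powr s * ?V * q ^ k)"
    proof -
      have "((2::real) ^ k) ^ ?n = (2 ^ ?n) ^ k" by (metis power_mult mult.commute)
      then have eq: "2 powr s * (2 powr (- s)) ^ k * (?V * (2 ^ k) ^ ?n) = 2 powr s * ?V * q ^ k"
        by (simp only: q_def power_mult_distrib mult_ac)
      show ?thesis unfolding eq[symmetric] by (rule ennreal_mult[symmetric]) auto
    qed
    finally show "(\<integral>\<^sup>+z. ennreal (2 powr s * (2 powr (- s)) ^ k) * indicator (ball (0::'a) (2 ^ k)) z \<partial>lborel)
      = ennreal (2 powr s * ?V * q ^ k)" .
  qed
  also have "\<dots> < \<infinity>"
  proof -
    have "summable (\<lambda>k. 2 powr s * ?V * q ^ k)"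
      using q by (intro summable_mult summable_geometric) auto
    then have "(\<Sum>k. ennreal (2 powr s * ?V * q ^ k)) \<noteq> top"
      by (rule ennreal_suminf_neq_top) (use q in auto)
    then show ?thesis by (simp only: infinity_ennreal_def less_top)
  qed
  finally show ?thesis .
qed

text \<open>Volume count: the balls of radius \<open>a / 2\<close> around the points are disjoint
  and lie in a ball of radius \<open>r + a / 2\<close>. Bounding all finite subsets yields
  finiteness of \<open>S\<close> as well.\<close>

lemma separated_card_le:
  fixes S :: "'a::euclidean_space set"
  assumes a: "a > 0" and r: "r > 0" and S: "S \<subseteq> ball z r"
    and sep: "\<And>p q. p \<in> S \<Longrightarrow> q \<in> S \<Longrightarrow> p \<noteq> q \<Longrightarrow> a \<le> dist p q"
  shows "finite S" "card S \<le> nat \<lfloor>((2 * r + a) / a) ^ DIM('a)\<rfloor>"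
proof -
  let ?n = "DIM('a)"
  let ?N = "nat \<lfloor>((2 * r + a) / a) ^ ?n\<rfloor>"
  have fm: "ball w e \<in> fmeasurable lborel" for w :: 'a and e
    using emeasure_bounded_finite[of "ball w e"] by (simp add: fmeasurable_def)
  have "card F \<le> ?N" if F: "finite F" "F \<subseteq> S" for F
  proof -
    have "disjoint_family_on (\<lambda>p. ball p (a / 2)) F"
      unfolding disjoint_family_on_def
    proof (intro ballI impI, rule ccontr)
      fix p q assume pq: "p \<in> F" "q \<in> F" "p \<noteq> q" "ball p (a / 2) \<inter> ball q (a / 2) \<noteq> {}"
      then obtain w where "dist p w < a / 2" "dist q w < a / 2" by auto
      then have "dist p q < a" using dist_triangle[of p q w] by (simp add: dist_commute)
      with sep[of p q] pq F show False by auto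
    qed
    then have "(\<Sum>p\<in>F. measure lborel (ball p (a / 2))) = measure lborel (\<Union>p\<in>F. ball p (a / 2))"
      using F emeasure_bounded_finite[of "ball _ (a / 2) :: 'a set"]
      by (intro measure_finite_Union[symmetric]) (auto simp: less_top)
    also have "\<dots> \<le> measure lborel (ball z (r + a / 2))"
    proof (rule measure_mono_fmeasurable)
      show "(\<Union>p\<in>F. ball p (a / 2)) \<subseteq> ball z (r + a / 2)"
      proof
        fix w assume "w \<in> (\<Union>p\<in>F. ball p (a / 2))"
        then obtain p where "p \<in> F" "dist p w < a / 2" by auto
        moreover then have "dist z p < r" using F S by auto
        ultimately show "w \<in> ball z (r + a / 2)" using dist_triangle[of z w p] by simp
      qed
    qed (use F in \<open>auto intro: fm fmeasurableD\<close>)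
    finally have "real (card F) * (unit_ball_vol ?n * (a / 2) ^ ?n) \<le> unit_ball_vol ?n * (r + a / 2) ^ ?n"
      using a r by (simp add: content_ball)
    then have "real (card F) * (a / 2) ^ ?n \<le> (r + a / 2) ^ ?n"
      by (simp add: mult.left_commute)
    then have "real (card F) \<le> (r + a / 2) ^ ?n / (a / 2) ^ ?n"
      using a by (simp add: pos_le_divide_eq)
    also have "\<dots> = ((2 * r + a) / a) ^ ?n"
    proof -
      have "(r + a / 2) / (a / 2) = (2 * r + a) / a" using a by (simp add: field_simps)
      then show ?thesis unfolding power_divide[symmetric] by (simp only:)
    qed
    finally show ?thesis by (simp add: le_nat_floor)
  qed
  then show "finite S" "card S \<le> ?N"
    using finite_if_finite_subsets_card_bdd[of S ?N] by auto
qed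

text \<open>Distinct points differ in some coordinate by a nonzero integer multiple of
  \<open>a\<close> or \<open>b\<close>. The common lower bound \<open>c\<close> makes the separation
  uniform over a family of lattices.\<close>

lemma separable_lattice_separated:
  fixes p q :: "('d::finite) phase"
  assumes pq: "p \<in> separable_lattice a b" "q \<in> separable_lattice a b" "p \<noteq> q"
    and c: "0 \<le> c" "c \<le> a" "c \<le> b"
  shows "c \<le> dist p q"
proof -
  have vec: "c \<le> dist u v"
    if uv: "\<forall>i. \<exists>k::int. u $ i = e * of_int k" "\<forall>i. \<exists>k::int. v $ i = e * of_int k" "u \<noteq> v" "c \<le> e"
    for u v :: "real ^ 'd" and e
  proof -
    obtain i where i: "u $ i \<noteq> v $ i" using \<open>u \<noteq> v\<close> by (auto simp: vec_eq_iff)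
    obtain k l :: int where kl: "u $ i = e * of_int k" "v $ i = e * of_int l" using uv by metis
    have "k \<noteq> l" using i kl by auto
    then have "1 \<le> \<bar>real_of_int (k - l)\<bar>" by linarith
    then have "e * 1 \<le> e * \<bar>real_of_int (k - l)\<bar>" using c that by (intro mult_left_mono) auto
    also have "\<dots> = dist (u $ i) (v $ i)"
      using c that by (simp add: kl dist_real_def abs_mult flip: right_diff_distrib)
    also have "\<dots> \<le> dist u v" by (rule dist_vec_nth_le)
    finally show ?thesis using that by simp
  qed
  show ?thesis
  proof (cases "fst p = fst q")
    case True
    then have "c \<le> dist (snd p) (snd q)"
      using pq c by (intro vec[of _ b]) (auto simp: separable_lattice_def prod_eq_iff)
    then show ?thesis using dist_snd_le[of p q] by simp
  next
    case False
    then have "c \<le> dist (fst p) (fst q)"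
      using pq c by (intro vec[of _ a]) (auto simp: separable_lattice_def)
    then show ?thesis using dist_fst_le[of p q] by simp
  qed
qed

text \<open>From \<open>norm (z - w) <= norm (z - l) + 1\<close> and
  \<open>(p + 1)^2 <= 2 * p^2 + 2\<close> the bases \<open>1 + ...\<close> differ by a factor of at
  most 3.\<close>

lemma decay_slowly_varying:
  fixes z l w :: "'a::real_normed_vector"
  assumes s: "s > 0" and w: "dist l w \<le> 1"
  shows "(1 + (norm (z - l))\<^sup>2) powr (- s / 2) \<le> 3 powr (s / 2) * (1 + (norm (z - w))\<^sup>2) powr (- s / 2)"
proof -
  have "norm (z - w) \<le> norm (z - l) + 1"
    using norm_triangle_ineq[of "z - l" "l - w"] w by (simp add: dist_norm)
  then have "(norm (z - w))\<^sup>2 \<le> (norm (z - l) + 1)\<^sup>2" by (intro power_mono) auto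
  also have "\<dots> \<le> 2 * (norm (z - l))\<^sup>2 + 2"
    using sum_squares_bound[of "norm (z - l)" 1] by (simp add: power2_sum)
  finally have "(norm (z - w))\<^sup>2 \<le> 2 * (norm (z - l))\<^sup>2 + 2" .
  then have "(1 + (norm (z - w))\<^sup>2) / 3 \<le> 1 + (norm (z - l))\<^sup>2"
  proof -
    have "(1 + A) / 3 \<le> 1 + B" if "A \<le> 2 * B + 2" "0 \<le> B" for A B :: real
      using that by simp
    then show ?thesis using \<open>(norm (z - w))\<^sup>2 \<le> 2 * (norm (z - l))\<^sup>2 + 2\<close> zero_le_power2 by blast
  qed
  then have "(1 + (norm (z - l))\<^sup>2) powr (- s / 2) \<le> ((1 + (norm (z - w))\<^sup>2) / 3) powr (- s / 2)"
    using s by (intro powr_mono2') (auto simp: add_pos_nonneg)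
  also have "\<dots> = (1 + (norm (z - w))\<^sup>2) powr (- s / 2) / 3 powr (- s / 2)"
    by (rule powr_divide)
  also have "3 powr (- s / 2) = inverse (3 powr (s / 2))"
    by (simp add: powr_minus)
  finally show ?thesis
    by (simp only: divide_inverse inverse_inverse_eq mult.commute)
qed

text \<open>Each weight is compared with its average over the unit ball around the point.\<close>

lemma sum_decay_le:
  fixes pt :: "'i \<Rightarrow> 'a::euclidean_space"
  assumes s: "s > 0" and P: "finite P"
    and N: "\<And>w. card {i \<in> P. pt i \<in> ball w 1} \<le> N"
  shows "(\<Sum>i\<in>P. ennreal ((1 + (norm (z - pt i))\<^sup>2) powr (- s / 2))) * ennreal (unit_ball_vol DIM('a))
    \<le> ennreal (3 powr (s / 2)) * of_nat N * (\<integral>\<^sup>+w. ennreal ((1 + (norm (w::'a))\<^sup>2) powr (- s / 2)) \<partial>lborel)"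
proof -
  define \<Phi> where "\<Phi> w = ennreal ((1 + (norm (w::'a))\<^sup>2) powr (- s / 2))" for w
  have [measurable]: "\<Phi> \<in> borel_measurable borel" unfolding \<Phi>_def by measurable
  have [measurable]: "ball (c::'a) r \<in> sets borel" for c r by simp
  have "(\<Sum>i\<in>P. \<Phi> (z - pt i)) * ennreal (unit_ball_vol DIM('a))
      = (\<Sum>i\<in>P. \<integral>\<^sup>+w. \<Phi> (z - pt i) * indicator (ball (pt i) 1) w \<partial>lborel)"
    by (simp add: sum_distrib_right nn_integral_cmult_indicator emeasure_ball)
  also have "\<dots> \<le> (\<Sum>i\<in>P. \<integral>\<^sup>+w. ennreal (3 powr (s / 2)) * \<Phi> (z - w) * indicator (ball (pt i) 1) w \<partial>lborel)"
  proof (intro sum_mono nn_integral_mono)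
    fix i w
    show "\<Phi> (z - pt i) * indicator (ball (pt i) 1) w \<le> ennreal (3 powr (s / 2)) * \<Phi> (z - w) * indicator (ball (pt i) 1) w"
      using decay_slowly_varying[OF s, of "pt i" w z]
      by (auto simp: \<Phi>_def indicator_def simp flip: ennreal_mult intro!: ennreal_leI)
  qed
  also have "\<dots> = (\<integral>\<^sup>+w. (\<Sum>i\<in>P. ennreal (3 powr (s / 2)) * \<Phi> (z - w) * indicator (ball (pt i) 1) w) \<partial>lborel)"
    by (subst nn_integral_sum) auto
  also have "\<dots> \<le> (\<integral>\<^sup>+w. ennreal (3 powr (s / 2)) * of_nat N * \<Phi> (z - w) \<partial>lborel)"
  proof (intro nn_integral_mono)
    fix w
    \<comment> \<open>By symmetry of the distance, the unit balls that contain \<open>w\<close> are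
      those centred in \<open>ball w 1\<close>, so at most \<open>N\<close> of them overlap at
      \<open>w\<close>.\<close>
    have "(\<Sum>i\<in>P. indicator (ball (pt i) 1) w) = (of_nat (card {i \<in> P. pt i \<in> ball w 1}) :: ennreal)"
    proof -
      have "(\<Sum>i\<in>P. indicator (ball (pt i) 1) w) = (\<Sum>i\<in>P. if pt i \<in> ball w 1 then 1 else (0::ennreal))"
        by (intro sum.cong) (auto simp: indicator_def dist_commute)
      also have "\<dots> = of_nat (card (P \<inter> {i. pt i \<in> ball w 1}))" using P by (simp add: sum.If_cases)
      also have "P \<inter> {i. pt i \<in> ball w 1} = {i \<in> P. pt i \<in> ball w 1}" by auto
      finally show ?thesis .
    qed
    also have "\<dots> \<le> of_nat N" using N[of w] by simp
    finally have "ennreal (3 powr (s / 2)) * \<Phi> (z - w) * (\<Sum>i\<in>P. indicator (ball (pt i) 1) w)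
      \<le> ennreal (3 powr (s / 2)) * \<Phi> (z - w) * of_nat N" by (rule mult_left_mono) simp
    then show "(\<Sum>i\<in>P. ennreal (3 powr (s / 2)) * \<Phi> (z - w) * indicator (ball (pt i) 1) w) \<le> ennreal (3 powr (s / 2)) * of_nat N * \<Phi> (z - w)"
      unfolding sum_distrib_left[symmetric] by (simp only: mult_ac)
  qed
  also have "\<dots> = ennreal (3 powr (s / 2)) * of_nat N * (\<integral>\<^sup>+w. \<Phi> (z - w) \<partial>lborel)"
    by (rule nn_integral_cmult) measurable
  \<comment> \<open>Invariance under the reflection \<open>w \<mapsto> z - w\<close> makes the bound
    independent of \<open>z\<close>.\<close>
  also have "(\<integral>\<^sup>+w. \<Phi> (z - w) \<partial>lborel) = (\<integral>\<^sup>+w. \<Phi> w \<partial>lborel)"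
    by (subst (2) nn_integral_lborel_affine[where t=z and c="-1"]) auto
  finally show ?thesis unfolding \<Phi>_def .
qed

section \<open>The Bessel bound\<close>

text \<open>Covariance and the decay of the window bound the transform of the shifted window by
  \<open>C * \<Phi> (z - l)\<close>. Cauchy-Schwarz is applied after splitting \<Phi> into two
  square roots, so that one full power of it stays next to the transform of \<open>f\<close> and can
  be summed over the points \<open>l\<close>.\<close>

lemma frame_coefficient_le:
  fixes f g :: "real ^ 'd \<Rightarrow> complex"
  assumes f: "f \<in> L2" and g: "g \<in> H_class s C" and C: "C > 0"
  defines "\<Phi> \<equiv> \<lambda>z::'d phase. (1 + (norm z)\<^sup>2) powr (- s / 2)"
  shows "ennreal ((gauss_energy TYPE('d))\<^sup>2) * ennreal ((cmod (L2_inner f (tf_shift l g)))\<^sup>2)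
    \<le> ennreal (C\<^sup>2) * (\<integral>\<^sup>+z. ennreal (\<Phi> z) \<partial>lborel)
       * (\<integral>\<^sup>+z. ennreal ((cmod (stft gaussian f z))\<^sup>2) * ennreal (\<Phi> (z - l)) \<partial>lborel)"
proof -
  let ?E = "gauss_energy TYPE('d)"
  have gL2: "g \<in> L2" and decay: "\<And>z. cmod (stft gaussian g z) \<le> C * \<Phi> z"
    using g by (auto simp: H_class_def \<Phi>_def)
  note [measurable] = L2D(1)[OF f] L2D(1)[OF gL2]
  have [measurable]: "\<Phi> \<in> borel_measurable borel" unfolding \<Phi>_def by measurable
  have \<Phi>0: "0 \<le> \<Phi> z" for z by (simp add: \<Phi>_def)
  let ?V = "\<lambda>z. ennreal (cmod (stft gaussian f z) * sqrt (\<Phi> (z - l)))"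
  let ?W = "\<lambda>z. ennreal (sqrt (\<Phi> (z - l)))"
  have "ennreal (?E * cmod (L2_inner f (tf_shift l g)))
      \<le> (\<integral>\<^sup>+z. ennreal (cmod (stft gaussian f z)) * ennreal (cmod (stft gaussian (tf_shift l g) z)) \<partial>lborel)"
    by (rule L2_inner_le_stft[OF f tf_shift_L2[OF gL2]])
  also have "\<dots> \<le> (\<integral>\<^sup>+z. ennreal C * (?V z * ?W z) \<partial>lborel)"
  proof (intro nn_integral_mono)
    fix z :: "'d phase"
    have "cmod (stft gaussian f z) * cmod (stft gaussian (tf_shift l g) z)
      \<le> cmod (stft gaussian f z) * (C * (sqrt (\<Phi> (z - l)) * sqrt (\<Phi> (z - l))))"
      using decay[of "z - l"] \<Phi>0[of "z - l"]
      by (intro mult_left_mono) (auto simp: stft_tf_shift)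
    also have "\<dots> = C * (cmod (stft gaussian f z) * sqrt (\<Phi> (z - l)) * sqrt (\<Phi> (z - l)))"
      by (simp only: mult_ac)
    finally show "ennreal (cmod (stft gaussian f z)) * ennreal (cmod (stft gaussian (tf_shift l g) z)) \<le> ennreal C * (?V z * ?W z)"
      using C \<Phi>0 by (simp add: ennreal_leI flip: ennreal_mult)
  qed
  also have "\<dots> = ennreal C * (\<integral>\<^sup>+z. ?V z * ?W z \<partial>lborel)"
    by (rule nn_integral_cmult) measurable
  finally have "(ennreal (?E * cmod (L2_inner f (tf_shift l g))))\<^sup>2 \<le> (ennreal C * (\<integral>\<^sup>+z. ?V z * ?W z \<partial>lborel))\<^sup>2"
    by (intro power_mono) auto
  also have "\<dots> \<le> (ennreal C)\<^sup>2 * ((\<integral>\<^sup>+z. (?V z)\<^sup>2 \<partial>lborel) * (\<integral>\<^sup>+z. (?W z)\<^sup>2 \<partial>lborel))"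
    unfolding power_mult_distrib by (intro mult_left_mono Cauchy_Schwarz_nn_integral) auto
  also have "(\<integral>\<^sup>+z. (?W z)\<^sup>2 \<partial>lborel) = (\<integral>\<^sup>+z. ennreal (\<Phi> (- l + 1 *\<^sub>R z)) \<partial>lborel)"
    using \<Phi>0 by (simp add: ennreal_power)
  also have "\<dots> = (\<integral>\<^sup>+z. ennreal (\<Phi> z) \<partial>lborel)"
    by (subst (2) nn_integral_lborel_affine[where t="- l" and c=1]) auto
  also have "(\<integral>\<^sup>+z. (?V z)\<^sup>2 \<partial>lborel) = (\<integral>\<^sup>+z. ennreal ((cmod (stft gaussian f z))\<^sup>2) * ennreal (\<Phi> (z - l)) \<partial>lborel)"
    using \<Phi>0 by (simp add: ennreal_power power_mult_distrib flip: ennreal_mult)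
  finally show ?thesis
    using C gauss_energy_pos[where 'd='d]
    by (simp add: ennreal_power power_mult_distrib mult_ac flip: ennreal_mult)
qed

text \<open>The point configuration enters only through the number of its points in a unit ball.\<close>

lemma finite_bessel_bound:
  assumes s: "s > 2 * real CARD('d::finite)" and C: "C > 0"
  obtains B :: real where "\<And>(P :: 'i set) (pt :: 'i \<Rightarrow> 'd phase) g f.
    \<lbrakk>finite P; \<And>w. card {i \<in> P. pt i \<in> ball w 1} \<le> N; \<And>i. i \<in> P \<Longrightarrow> g i \<in> H_class s C; f \<in> L2\<rbrakk>
    \<Longrightarrow> (\<Sum>i\<in>P. ennreal ((cmod (L2_inner f (tf_shift (pt i) (g i))))\<^sup>2)) \<le> ennreal (B * (L2_norm f)\<^sup>2)"
proof -
  let ?E = "gauss_energy TYPE('d)"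
  define \<Phi> where "\<Phi> z = (1 + (norm z)\<^sup>2) powr (- s / 2)" for z :: "'d phase"
  have [measurable]: "\<Phi> \<in> borel_measurable borel" unfolding \<Phi>_def by measurable
  have E: "?E > 0" by (rule gauss_energy_pos)
  have s0: "s > 0" using le_less_trans[OF _ s, of 0] by simp
  have "(\<integral>\<^sup>+z. ennreal (\<Phi> z) \<partial>lborel) < \<infinity>"
    unfolding \<Phi>_def by (rule decay_nn_integral_finite) (use s in simp)
  then obtain A where A: "A \<ge> 0" "(\<integral>\<^sup>+z. ennreal (\<Phi> z) \<partial>lborel) = ennreal A"
    by (cases "\<integral>\<^sup>+z. ennreal (\<Phi> z) \<partial>lborel") auto
  define v where "v = unit_ball_vol (real DIM('d phase))"
  have v: "v > 0" by (simp add: v_def)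
  \<comment> \<open>The bound of \<open>sum_decay_le\<close> divided by the volume \<open>v\<close>
    of the unit ball.\<close>
  define D where "D = 3 powr (s / 2) * real N * A / v"
  have D0: "D \<ge> 0" using A v by (simp add: D_def)
  \<comment> \<open>The coefficient estimate carries the square of \<open>?E\<close> on the left and
    the norm bound for the transform contributes one \<open>?E\<close> on the right, which leaves a
    single \<open>?E\<close> in the denominator.\<close>
  define B where "B = C\<^sup>2 * A * D / ?E"
  show thesis
  proof (rule that[of B])
    fix P :: "'i set" and pt :: "'i \<Rightarrow> 'd phase"
      and g :: "'i \<Rightarrow> real ^ 'd \<Rightarrow> complex" and f :: "real ^ 'd \<Rightarrow> complex"
    assume P: "finite P" and N: "\<And>w. card {i \<in> P. pt i \<in> ball w 1} \<le> N"
      and g: "\<And>i. i \<in> P \<Longrightarrow> g i \<in> H_class s C" and f: "f \<in> L2"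
    note [measurable] = L2D(1)[OF f]
    have Dsum: "(\<Sum>i\<in>P. ennreal (\<Phi> (z - pt i))) \<le> ennreal D" for z
    proof -
      have "(\<Sum>i\<in>P. ennreal (\<Phi> (z - pt i))) * ennreal v \<le> ennreal (3 powr (s / 2) * real N * A)"
        using sum_decay_le[OF s0 P N, of z] A unfolding \<Phi>_def[symmetric] v_def[symmetric]
        by (simp add: ennreal_mult ennreal_of_nat_eq_real_of_nat)
      also have "\<dots> = ennreal D * ennreal v"
        using v D0 by (simp add: D_def flip: ennreal_mult)
      finally have "ennreal v * (\<Sum>i\<in>P. ennreal (\<Phi> (z - pt i))) \<le> ennreal v * ennreal D"
        by (simp only: mult.commute)
      then show ?thesis
        by (subst (asm) ennreal_mult_le_mult_iff) (use v in auto)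
    qed
    have "ennreal (?E\<^sup>2) * (\<Sum>i\<in>P. ennreal ((cmod (L2_inner f (tf_shift (pt i) (g i))))\<^sup>2))
      \<le> (\<Sum>i\<in>P. ennreal (C\<^sup>2) * ennreal A * (\<integral>\<^sup>+z. ennreal ((cmod (stft gaussian f z))\<^sup>2) * ennreal (\<Phi> (z - pt i)) \<partial>lborel))"
      unfolding sum_distrib_left A(2)[symmetric] \<Phi>_def by (intro sum_mono frame_coefficient_le f g C)
    also have "\<dots> = ennreal (C\<^sup>2) * ennreal A * (\<integral>\<^sup>+z. ennreal ((cmod (stft gaussian f z))\<^sup>2) * (\<Sum>i\<in>P. ennreal (\<Phi> (z - pt i))) \<partial>lborel)"
      unfolding sum_distrib_left[symmetric] by (subst nn_integral_sum[symmetric]) (auto simp: sum_distrib_left)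
    also have "\<dots> \<le> ennreal (C\<^sup>2) * ennreal A * (\<integral>\<^sup>+z. ennreal ((cmod (stft gaussian f z))\<^sup>2) * ennreal D \<partial>lborel)"
      by (intro mult_left_mono nn_integral_mono Dsum) auto
    also have "\<dots> = ennreal (C\<^sup>2) * ennreal A * ((\<integral>\<^sup>+z. ennreal ((cmod (stft gaussian f z))\<^sup>2) \<partial>lborel) * ennreal D)"
      by (subst nn_integral_multc) auto
    also have "\<dots> \<le> ennreal (C\<^sup>2) * ennreal A * (ennreal (?E * (L2_norm f)\<^sup>2) * ennreal D)"
      by (intro mult_left_mono mult_right_mono stft_norm_bound f) auto
    also have "\<dots> = ennreal (?E\<^sup>2) * ennreal (B * (L2_norm f)\<^sup>2)"
    proof -
      have "C\<^sup>2 * A * (?E * (L2_norm f)\<^sup>2 * D) = ?E\<^sup>2 * (B * (L2_norm f)\<^sup>2)"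
        using E by (simp add: B_def power2_eq_square)
      moreover have "ennreal (C\<^sup>2) * ennreal A * (ennreal (?E * (L2_norm f)\<^sup>2) * ennreal D)
          = ennreal (C\<^sup>2 * A * (?E * (L2_norm f)\<^sup>2 * D))"
        using A(1) D0 E by (simp add: ennreal_mult)
      moreover have "ennreal (?E\<^sup>2 * (B * (L2_norm f)\<^sup>2)) = ennreal (?E\<^sup>2) * ennreal (B * (L2_norm f)\<^sup>2)"
        using A(1) D0 E by (intro ennreal_mult) (auto simp: B_def)
      ultimately show ?thesis by (simp only:)
    qed
    finally show "(\<Sum>i\<in>P. ennreal ((cmod (L2_inner f (tf_shift (pt i) (g i))))\<^sup>2)) \<le> ennreal (B * (L2_norm f)\<^sup>2)"
      using E by (simp add: ennreal_mult_le_mult_iff)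
  qed
qed

text \<open>Balls with the common point \<open>w\<close> meet pairwise, so \<open>F\<close> lies in
  the neighbourhood of any one of its members.\<close>

lemma card_covering_balls_le:
  assumes n0: "\<And>r. r \<in> I \<Longrightarrow> finite (ball_neighbours I x R r) \<and> card (ball_neighbours I x R r) \<le> n0"
    and F: "F \<subseteq> I" "\<And>r. r \<in> F \<Longrightarrow> w \<in> ball (x r) (R r)"
  shows "card F \<le> n0"
proof (cases "F = {}")
  case False
  then obtain r where r: "r \<in> F" by auto
  then have "F \<subseteq> ball_neighbours I x R r"
    using F by (fastforce simp: ball_neighbours_def)
  then show ?thesis
    using n0[of r] r F card_mono order_trans by blast
qed simp

theorem theorem1:
  fixes g :: "'j \<Rightarrow> real ^ 'd \<Rightarrow> complex"
    and \<alpha> \<beta> :: "'j \<Rightarrow> real"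
    and J :: "'j set" and I :: "'i set"
    and \<Omega> :: "'i \<Rightarrow> 'd phase set"
    and x :: "'i \<Rightarrow> 'd phase" and R :: "'i \<Rightarrow> real"
    and \<psi> :: "'i \<Rightarrow> 'd phase \<Rightarrow> real"
    and m :: "'i \<Rightarrow> 'j"
    and s C \<alpha>0 \<alpha>1 \<beta>0 \<beta>1 \<delta> :: real
  assumes frames: "\<And>j. j \<in> J \<Longrightarrow> gabor_frame (g j) (separable_lattice (\<alpha> j) (\<beta> j))"
    and covering: "admissible_covering I \<Omega> x R"
    and s: "s > 2 * real CARD('d)" and C: "C > 0"
    and windows: "\<And>j. j \<in> J \<Longrightarrow> g j \<in> H_class s C"
    and \<alpha>0: "0 < \<alpha>0" and \<beta>0: "0 < \<beta>0"
    and \<alpha>: "\<And>j. j \<in> J \<Longrightarrow> \<alpha> j \<in> {\<alpha>0..\<alpha>1}"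
    and \<beta>: "\<And>j. j \<in> J \<Longrightarrow> \<beta> j \<in> {\<beta>0..\<beta>1}"
    and partition: "bounded_admissible_partition I \<psi> x R"
    and supports: "\<And>r. r \<in> I \<Longrightarrow> supp (\<psi> r) \<subseteq> \<Omega> r"
    and m: "m \<in> I \<rightarrow> J"
    and \<delta>: "\<delta> \<ge> 0"
  shows "\<exists>B::real. \<forall>f\<in>L2.
    (\<Sum>\<^sub>\<infinity>r\<in>I. \<Sum>\<^sub>\<infinity>z\<in>separable_lattice (\<alpha> (m r)) (\<beta> (m r)) \<inter> ball (x r) (R r + \<delta>).
        ennreal ((cmod (L2_inner f (tf_shift z (g (m r)))))\<^sup>2))
      \<le> ennreal (B * (L2_norm f)\<^sup>2)"
proof -
  define X where "X r = separable_lattice (\<alpha> (m r)) (\<beta> (m r)) \<inter> ball (x r) (R r + \<delta>)" for r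
  \<comment> \<open>One separation constant for all lattices of the family, from the lower ends of
    the parameter intervals.\<close>
  define a where "a = min \<alpha>0 \<beta>0"
  have a: "a > 0" using \<alpha>0 \<beta>0 by (simp add: a_def)
  have sep: "a \<le> dist p q" if "r \<in> I" "p \<in> X r" "q \<in> X r" "p \<noteq> q" for r p q
  proof (rule separable_lattice_separated)
    have "m r \<in> J" using m that by auto
    then show "a \<le> \<alpha> (m r)" "a \<le> \<beta> (m r)" using \<alpha> \<beta> by (force simp: a_def)+
  qed (use that a in \<open>auto simp: X_def\<close>)
  have balls: "admissible_balls I x (\<lambda>r. R r + \<rho>)" if "\<rho> > 0" for \<rho>
    using covering that by (simp add: admissible_covering_def)
  \<comment> \<open>The enlargement consists of \<delta> from the definition of \<open>X\<close> and
    1 for the unit test ball: if \<open>X r\<close> meets \<open>ball w 1\<close>, then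
    \<open>w\<close> has distance less than \<open>R r + \<delta> + 1\<close> from
    \<open>x r\<close>.\<close>
  have "admissible_balls I x (\<lambda>r. R r + (\<delta> + 1))" using balls \<delta> by simp
  then obtain n0 where n0: "\<forall>r\<in>I. finite (ball_neighbours I x (\<lambda>r. R r + (\<delta> + 1)) r)
      \<and> card (ball_neighbours I x (\<lambda>r. R r + (\<delta> + 1)) r) \<le> n0"
    unfolding admissible_balls_def by blast
  \<comment> \<open>Finiteness turns the inner sums into finite ones. The sizes need not be bounded
    in \<open>r\<close>, since the radii may be unbounded; the uniform count is
    \<open>XK\<close>.\<close>
  have Xfin: "finite (X r)" if "r \<in> I" for r
  proof -
    have "0 < R r" using covering that by (simp add: admissible_covering_def admissible_balls_def)
    then show ?thesis
      using separated_card_le(1)[OF a, of "R r + \<delta>" "X r" "x r"] sep[OF that] \<delta> by (auto simp: X_def)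
  qed
  define K where "K = nat \<lfloor>((2 * 1 + a) / a) ^ DIM('d phase)\<rfloor>"
  have XK: "card (X r \<inter> ball w 1) \<le> K" if "r \<in> I" for r w
    unfolding K_def using sep[OF that] by (intro separated_card_le(2)[OF a]) auto
  \<comment> \<open>The index set consists of pairs: the same phase space point may occur for
    several \<open>r\<close> with different windows and is then counted each time.\<close>
  obtain B :: real where B: "\<And>(P :: ('i \<times> 'd phase) set) (pt :: 'i \<times> 'd phase \<Rightarrow> 'd phase) g f.
    \<lbrakk>finite P; \<And>w. card {i \<in> P. pt i \<in> ball w 1} \<le> n0 * K; \<And>i. i \<in> P \<Longrightarrow> g i \<in> H_class s C; f \<in> L2\<rbrakk>
    \<Longrightarrow> (\<Sum>i\<in>P. ennreal ((cmod (L2_inner f (tf_shift (pt i) (g i))))\<^sup>2)) \<le> ennreal (B * (L2_norm f)\<^sup>2)"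
    by (rule finite_bessel_bound[OF s C, of "n0 * K"], erule that)
  show ?thesis
  proof (intro exI[of _ B] ballI)
    fix f :: "real ^ 'd \<Rightarrow> complex" assume f: "f \<in> L2"
    let ?c = "\<lambda>r z. ennreal ((cmod (L2_inner f (tf_shift z (g (m r)))))\<^sup>2)"
    have "(\<Sum>\<^sub>\<infinity>r\<in>I. \<Sum>\<^sub>\<infinity>z\<in>X r. ?c r z) \<le> ennreal (B * (L2_norm f)\<^sup>2)"
    \<comment> \<open>It suffices to treat finite index sets \<open>F\<close>, because
      \<open>B\<close> was fixed before \<open>F\<close>.\<close>
    proof (rule infsum_le_finite_sums)
      fix F assume F: "finite F" "F \<subseteq> I"
      have count: "card {i \<in> Sigma F X. snd i \<in> ball w 1} \<le> n0 * K" for w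
      proof -
        \<comment> \<open>Only these indices contribute points to the unit ball: at most
          \<open>n0\<close> of them by the covering, each with at most \<open>K\<close> points by
          separation.\<close>
        define G where "G = {r \<in> F. X r \<inter> ball w 1 \<noteq> {}}"
        have "card G \<le> n0"
        proof (rule card_covering_balls_le[OF n0[rule_format]])
          fix r assume "r \<in> G"
          then obtain p where "p \<in> X r" "dist w p < 1" by (auto simp: G_def)
          then show "w \<in> ball (x r) (R r + (\<delta> + 1))"
            using dist_triangle[of "x r" w p] by (auto simp: X_def dist_commute)
        qed (use F in \<open>auto simp: G_def\<close>)
        have "{i \<in> Sigma F X. snd i \<in> ball w 1} = Sigma G (\<lambda>r. X r \<inter> ball w 1)"
          by (auto simp: G_def)
        moreover have "card (Sigma G (\<lambda>r. X r \<inter> ball w 1)) = (\<Sum>r\<in>G. card (X r \<inter> ball w 1))"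
          by (rule card_SigmaI) (use F Xfin in \<open>auto simp: G_def\<close>)
        ultimately have "card {i \<in> Sigma F X. snd i \<in> ball w 1} = (\<Sum>r\<in>G. card (X r \<inter> ball w 1))"
          by (simp only:)
        also have "\<dots> \<le> (\<Sum>r\<in>G. K)" using F by (intro sum_mono XK) (auto simp: G_def)
        also have "\<dots> \<le> n0 * K" using \<open>card G \<le> n0\<close> by simp
        finally show ?thesis .
      qed
      have "(\<Sum>r\<in>F. \<Sum>\<^sub>\<infinity>z\<in>X r. ?c r z) = (\<Sum>r\<in>F. \<Sum>z\<in>X r. ?c r z)"
        using F Xfin by (intro sum.cong infsum_finite) auto
      also have "\<dots> = (\<Sum>i\<in>Sigma F X. ennreal ((cmod (L2_inner f (tf_shift (snd i) (g (m (fst i))))))\<^sup>2))"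
        using F Xfin by (subst sum.Sigma) (auto simp: split_beta')
      also have "\<dots> \<le> ennreal (B * (L2_norm f)\<^sup>2)"
        using F Xfin m by (intro B count f windows) auto
      finally show "(\<Sum>r\<in>F. \<Sum>\<^sub>\<infinity>z\<in>X r. ?c r z) \<le> ennreal (B * (L2_norm f)\<^sup>2)" .
    qed (simp add: nonneg_summable_on_complete)
    then show "(\<Sum>\<^sub>\<infinity>r\<in>I. \<Sum>\<^sub>\<infinity>z\<in>separable_lattice (\<alpha> (m r)) (\<beta> (m r)) \<inter> ball (x r) (R r + \<delta>). ?c r z) \<le> ennreal (B * (L2_norm f)\<^sup>2)"
      unfolding X_def .
  qed
qed

end
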